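(* Assume the van Kampen setup below, with compatible future retracts $Q_k:\vec\pi_1(X_k)\to\vec\pi_1(X_k,B_k)$ and compatible future retracts $P_k:\vec\pi_1(X_k,B_k)\to\vec\pi_1(X_k,A_k)$ ($k=0,1,2$). Then the commutative cube formed by the square $(i'_1,i'_2,j'_1,j'_2)$ of the categories $\vec\pi_1(X_k,A_k)$, $\vec\pi_1(X,A)$, the square $(i_1,i_2,j_1,j_2)$ of the categories $\vec\pi_1(X_k,B_k)$, $\vec\pi_1(X,B)$, and the inclusion functors $\iota_0,\iota_1,\iota_2,\iota$ between them, is a pushout in the arrow category of $\mathbf{Cat}$; that is, $\iota$ is the pushout of $\iota_1$ and $\iota_2$ over $\iota_0$ in the category whose objects are functors and whose morphisms are commutative squares.
   Context: A d-space is a topological space with a set of continuous paths $[0,1]\to X$ (dipaths) containing all constant paths, closed under precomposition with continuous non-decreasing maps $[0,1]\to[0,1]$ and under concatenation; subsets carry the dipaths with image in them. The fundamental category $\vec\pi_1(X)$ has objects the points of $X$ and morphisms $a\to b$ the classes of dipaths from $a$ to $b$ modulo the equivalence relation generated by endpoint-fixing directed homotopies; composition is concatenation. For $A\subseteq X$, $\vec\pi_1(X,A)$ is the full subcategory on objects in $A$. For $A\subseteq B\subseteq X$ with inclusion $\iota:\vec\pi_1(X,A)\to\vec\pi_1(X,B)$, a future retract is a functor $P:\vec\pi_1(X,B)\to\vec\pi_1(X,A)$ left adjoint to $\iota$ whose unit satisfies $\eta_a=\mathrm{id}_a$ for $a\in A$. Van Kampen setup: $X$ a d-space, $X_1,X_2\subseteq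 X$ with $X=\mathrm{Int}(X_1)\cup\mathrm{Int}(X_2)$, dipaths of $X$ the finite concatenations of dipaths of $X_1$ and $X_2$, $X_0=X_1\cap X_2$. For $k=0,1,2$, $A_k\subseteq B_k\subseteq X_k$ with $A_0=A_1\cap A_2$, $B_0=B_1\cap B_2$, $A=A_1\cup A_2$, $B=B_1\cup B_2$, $A=\mathrm{Int}_A(A_1)\cup\mathrm{Int}_A(A_2)$, $B=\mathrm{Int}_B(B_1)\cup\mathrm{Int}_B(B_2)$. Inclusion-induced functors: $i_k:\vec\pi_1(X_0,B_0)\to\vec\pi_1(X_k,B_k)$, $j_k:\vec\pi_1(X_k,B_k)\to\vec\pi_1(X,B)$, $i'_k:\vec\pi_1(X_0,A_0)\to\vec\pi_1(X_k,A_k)$, $j'_k:\vec\pi_1(X_k,A_k)\to\vec\pi_1(X,A)$ ($k=1,2$); inclusions $\iota_k:\vec\pi_1(X_k,A_k)\to\vec\pi_1(X_k,B_k)$ ($k=0,1,2$), $\iota:\vec\pi_1(X,A)\to\vec\pi_1(X,B)$. Compatible future retracts $Q_k:\vec\pi_1(X_k)\to\vec\pi_1(X_k,B_k)$: each a future retract with unit $\theta^k$, commuting with the inclusion-induced functors from index $0$ to $k=1,2$, with $\theta^0_x$ mapping to $\theta^k_x$ for $x\in X_0$. Compatible future retracts $P_k:\vec\pi_1(X_k,B_k)\to\vec\pi_1(X_k,A_k)$: each a future retract with unit $\eta^k$, $P_k\circ i_k=i'_k\circ P_0$ ($k=1,2$), and $\eta^0_x$ mapping to $\eta^k_x$ for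 $x\in B_0$. *)

theory Defs
  imports "HOL-Analysis.Analysis"
begin

text \<open>Concatenation of paths (same formula as joinpaths, for arbitrary codomain).\<close>
definition pconcat :: "(real \<Rightarrow> 'a) \<Rightarrow> (real \<Rightarrow> 'a) \<Rightarrow> real \<Rightarrow> 'a" where
  "pconcat p q = (\<lambda>t. if t \<le> 1/2 then p (2 * t) else q (2 * t - 1))"

text \<open>A d-space is a topological space T (carrier topspace T) together with a set D of
dipaths, paths being functions real => 'a whose behaviour on [0,1] matters.
Convention: D is closed under changing a path outside [0,1].\<close>

definition dspace :: "'a topology \<Rightarrow> (real \<Rightarrow> 'a) set \<Rightarrow> bool" where
  "dspace T D \<longleftrightarrow>
     (\<forall>p\<in>D. continuous_map (top_of_set {0..1}) T p) \<and>
     (\<forall>p\<in>D. \<forall>q. (\<forall>t\<in>{0..1}. q t = p t) \<longrightarrow> q \<in> D) \<and>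
     (\<forall>x\<in>topspace T. (\<lambda>t. x) \<in> D) \<and>
     (\<forall>p\<in>D. \<forall>\<phi>. continuous_on {0..1} \<phi> \<and> \<phi> ` {0..1} \<subseteq> {0..1} \<and> mono_on {0..1} \<phi>
                 \<longrightarrow> p \<circ> \<phi> \<in> D) \<and>
     (\<forall>p\<in>D. \<forall>q\<in>D. p 1 = q 0 \<longrightarrow> pconcat p q \<in> D)"

definition dipaths :: "(real \<Rightarrow> 'a) set \<Rightarrow> 'a set \<Rightarrow> (real \<Rightarrow> 'a) set" where
  "dipaths D Y = {p \<in> D. p ` {0..1} \<subseteq> Y}"

text \<open>Endpoint-fixing directed homotopy in Y from p to q: a d-map from the directed
square (dipaths = continuous paths with both coordinates non-decreasing) to Y.\<close>
definition dihomotopic :: "'a topology \<Rightarrow> (real \<Rightarrow> 'a) set \<Rightarrow> 'a set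
    \<Rightarrow> (real \<Rightarrow> 'a) \<Rightarrow> (real \<Rightarrow> 'a) \<Rightarrow> bool" where
  "dihomotopic T D Y p q \<longleftrightarrow> p \<in> dipaths D Y \<and> q \<in> dipaths D Y \<and>
     (\<exists>H :: real \<times> real \<Rightarrow> 'a.
        continuous_map (top_of_set ({0..1} \<times> {0..1})) (subtopology T Y) H \<and>
        (\<forall>\<gamma> :: real \<Rightarrow> real \<times> real.
            continuous_on {0..1} \<gamma> \<and> \<gamma> ` {0..1} \<subseteq> {0..1} \<times> {0..1} \<and>
            mono_on {0..1} (fst \<circ> \<gamma>) \<and> mono_on {0..1} (snd \<circ> \<gamma>)
            \<longrightarrow> H \<circ> \<gamma> \<in> D) \<and>
        (\<forall>t\<in>{0..1}. H (0, t) = p t \<and> H (1, t) = q t) \<and>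
        (\<forall>s\<in>{0..1}. H (s, 0) = p 0 \<and> H (s, 1) = p 1))"

definition dhrel :: "'a topology \<Rightarrow> (real \<Rightarrow> 'a) set \<Rightarrow> 'a set
    \<Rightarrow> ((real \<Rightarrow> 'a) \<times> (real \<Rightarrow> 'a)) set" where
  "dhrel T D Y = {(p, q). dihomotopic T D Y p q \<or> dihomotopic T D Y q p}\<^sup>*"

definition dclass :: "'a topology \<Rightarrow> (real \<Rightarrow> 'a) set \<Rightarrow> 'a set
    \<Rightarrow> (real \<Rightarrow> 'a) \<Rightarrow> (real \<Rightarrow> 'a) set" where
  "dclass T D Y p = {q. (p, q) \<in> dhrel T D Y}"

record ('o, 'm) cat =
  Obj :: "'o set"
  Arr :: "'m set"
  Dom :: "'m \<Rightarrow> 'o"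
  Cod :: "'m \<Rightarrow> 'o"
  Id  :: "'o \<Rightarrow> 'm"
  Comp :: "'m \<Rightarrow> 'm \<Rightarrow> 'm"  \<comment> \<open>Comp g f = g after f\<close>

definition is_category :: "('o, 'm) cat \<Rightarrow> bool" where
  "is_category C \<longleftrightarrow>
     (\<forall>f\<in>Arr C. Dom C f \<in> Obj C \<and> Cod C f \<in> Obj C) \<and>
     (\<forall>a\<in>Obj C. Id C a \<in> Arr C \<and> Dom C (Id C a) = a \<and> Cod C (Id C a) = a) \<and>
     (\<forall>f\<in>Arr C. \<forall>g\<in>Arr C. Cod C f = Dom C g \<longrightarrow>
        Comp C g f \<in> Arr C \<and> Dom C (Comp C g f) = Dom C f \<and> Cod C (Comp C g f) = Cod C g) \<and>
     (\<forall>f\<in>Arr C. Comp C (Id C (Cod C f)) f = f \<and> Comp C f (Id C (Dom C f)) = f) \<and>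
     (\<forall>f\<in>Arr C. \<forall>g\<in>Arr C. \<forall>h\<in>Arr C. Cod C f = Dom C g \<and> Cod C g = Dom C h \<longrightarrow>
        Comp C h (Comp C g f) = Comp C (Comp C h g) f)"

record ('o1, 'm1, 'o2, 'm2) ftor =
  FObj :: "'o1 \<Rightarrow> 'o2"
  FArr :: "'m1 \<Rightarrow> 'm2"

definition is_functor :: "('o1, 'm1, 'o2, 'm2) ftor \<Rightarrow> ('o1, 'm1) cat \<Rightarrow> ('o2, 'm2) cat \<Rightarrow> bool" where
  "is_functor F C C' \<longleftrightarrow>
     (\<forall>a\<in>Obj C. FObj F a \<in> Obj C') \<and>
     (\<forall>f\<in>Arr C. FArr F f \<in> Arr C' \<and> Dom C' (FArr F f) = FObj F (Dom C f) \<and>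
                 Cod C' (FArr F f) = FObj F (Cod C f)) \<and>
     (\<forall>a\<in>Obj C. FArr F (Id C a) = Id C' (FObj F a)) \<and>
     (\<forall>f\<in>Arr C. \<forall>g\<in>Arr C. Cod C f = Dom C g \<longrightarrow>
        FArr F (Comp C g f) = Comp C' (FArr F g) (FArr F f))"

definition fcomp :: "('o2, 'm2, 'o3, 'm3) ftor \<Rightarrow> ('o1, 'm1, 'o2, 'm2) ftor \<Rightarrow> ('o1, 'm1, 'o3, 'm3) ftor" where
  "fcomp G F = \<lparr>FObj = FObj G \<circ> FObj F, FArr = FArr G \<circ> FArr F\<rparr>"

definition feq :: "('o1, 'm1) cat \<Rightarrow> ('o1, 'm1, 'o2, 'm2) ftor \<Rightarrow> ('o1, 'm1, 'o2, 'm2) ftor \<Rightarrow> bool" where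
  "feq C F G \<longleftrightarrow> (\<forall>a\<in>Obj C. FObj F a = FObj G a) \<and> (\<forall>f\<in>Arr C. FArr F f = FArr G f)"

text \<open>Future retract: P : CB -> CA left adjoint to the inclusion iota : CA -> CB, given via
its unit eta (natural, with universal components), with eta_a = id_a for a in CA.\<close>
definition future_retract :: "('o, 'm) cat \<Rightarrow> ('o, 'm) cat \<Rightarrow> ('o, 'm, 'o, 'm) ftor
    \<Rightarrow> ('o, 'm, 'o, 'm) ftor \<Rightarrow> ('o \<Rightarrow> 'm) \<Rightarrow> bool" where
  "future_retract CB CA \<iota> P \<eta> \<longleftrightarrow>
     is_functor P CB CA \<and>
     (\<forall>b\<in>Obj CB. \<eta> b \<in> Arr CB \<and> Dom CB (\<eta> b) = b \<and> Cod CB (\<eta> b) = FObj \<iota> (FObj P b)) \<and>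
     (\<forall>f\<in>Arr CB. Comp CB (\<eta> (Cod CB f)) f = Comp CB (FArr \<iota> (FArr P f)) (\<eta> (Dom CB f))) \<and>
     (\<forall>b\<in>Obj CB. \<forall>a\<in>Obj CA. \<forall>f\<in>Arr CB. Dom CB f = b \<and> Cod CB f = FObj \<iota> a \<longrightarrow>
        (\<exists>!g. g \<in> Arr CA \<and> Dom CA g = FObj P b \<and> Cod CA g = a \<and>
              Comp CB (FArr \<iota> g) (\<eta> b) = f)) \<and>
     (\<forall>a\<in>Obj CA. \<eta> (FObj \<iota> a) = Id CB (FObj \<iota> a))"

type_synonym 'a darr = "'a \<times> 'a \<times> (real \<Rightarrow> 'a) set"

definition fcat :: "'a topology \<Rightarrow> (real \<Rightarrow> 'a) set \<Rightarrow> 'a set \<Rightarrow> 'a set \<Rightarrow> ('a, 'a darr) cat" where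
  "fcat T D Y A = \<lparr>
     Obj = A,
     Arr = {(p 0, p 1, dclass T D Y p) | p. p \<in> dipaths D Y \<and> p 0 \<in> A \<and> p 1 \<in> A},
     Dom = fst,
     Cod = (\<lambda>f. fst (snd f)),
     Id = (\<lambda>a. (a, a, dclass T D Y (\<lambda>t. a))),
     Comp = (\<lambda>g f. (fst f, fst (snd g),
               dclass T D Y (pconcat (SOME p. p \<in> snd (snd f)) (SOME q. q \<in> snd (snd g)))))\<rparr>"

definition incl :: "'a topology \<Rightarrow> (real \<Rightarrow> 'a) set \<Rightarrow> 'a set \<Rightarrow> ('a, 'a darr, 'a, 'a darr) ftor" where
  "incl T D Y' = \<lparr>FObj = id, FArr = (\<lambda>(a, b, c). (a, b, dclass T D Y' (SOME p. p \<in> c)))\<rparr>"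

definition arrmor :: "('o1, 'm1) cat \<Rightarrow> ('o2, 'm2) cat \<Rightarrow> ('o1, 'm1, 'o2, 'm2) ftor
    \<Rightarrow> ('o3, 'm3) cat \<Rightarrow> ('o4, 'm4) cat \<Rightarrow> ('o3, 'm3, 'o4, 'm4) ftor
    \<Rightarrow> ('o1, 'm1, 'o3, 'm3) ftor \<Rightarrow> ('o2, 'm2, 'o4, 'm4) ftor \<Rightarrow> bool" where
  "arrmor C D f C' D' g u v \<longleftrightarrow>
     is_functor u C C' \<and> is_functor v D D' \<and> feq C (fcomp g u) (fcomp v f)"

definition arrow_cube where
  "arrow_cube A0 B0 f0 A1 B1 f1 A2 B2 f2 A B f i1' i1 i2' i2 j1' j1 j2' j2 \<longleftrightarrow>
     is_category A0 \<and> is_category B0 \<and> is_category A1 \<and> is_category B1 \<and>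
     is_category A2 \<and> is_category B2 \<and> is_category A \<and> is_category B \<and>
     is_functor f0 A0 B0 \<and> is_functor f1 A1 B1 \<and> is_functor f2 A2 B2 \<and> is_functor f A B \<and>
     arrmor A0 B0 f0 A1 B1 f1 i1' i1 \<and> arrmor A0 B0 f0 A2 B2 f2 i2' i2 \<and>
     arrmor A1 B1 f1 A B f j1' j1 \<and> arrmor A2 B2 f2 A B f j2' j2 \<and>
     feq A0 (fcomp j1' i1') (fcomp j2' i2') \<and> feq B0 (fcomp j1 i1) (fcomp j2 i2)"

definition arrow_po_univ where
  "arrow_po_univ A0 B0 f0 A1 B1 f1 A2 B2 f2 A B f i1' i1 i2' i2 j1' j1 j2' j2 C' D' g \<longleftrightarrow>
     (\<forall>u1 v1 u2 v2.
        arrmor A1 B1 f1 C' D' g u1 v1 \<and> arrmor A2 B2 f2 C' D' g u2 v2 \<and>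
        feq A0 (fcomp u1 i1') (fcomp u2 i2') \<and> feq B0 (fcomp v1 i1) (fcomp v2 i2) \<longrightarrow>
        (\<exists>u v. arrmor A B f C' D' g u v \<and>
               feq A1 (fcomp u j1') u1 \<and> feq B1 (fcomp v j1) v1 \<and>
               feq A2 (fcomp u j2') u2 \<and> feq B2 (fcomp v j2) v2 \<and>
               (\<forall>u' v'. arrmor A B f C' D' g u' v' \<and>
                   feq A1 (fcomp u' j1') u1 \<and> feq B1 (fcomp v' j1) v1 \<and>
                   feq A2 (fcomp u' j2') u2 \<and> feq B2 (fcomp v' j2) v2 \<longrightarrow>
                   feq A u' u \<and> feq B v' v)))"

definition finite_concat_of :: "(real \<Rightarrow> 'a) set \<Rightarrow> (real \<Rightarrow> 'a) set \<Rightarrow> (real \<Rightarrow> 'a) \<Rightarrow> bool" where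
  "finite_concat_of D1 D2 p \<longleftrightarrow>
     (\<exists>(n::nat) (t::nat \<Rightarrow> real). t 0 = 0 \<and> t n = 1 \<and> (\<forall>i<n. t i < t (Suc i)) \<and>
        (\<forall>i<n. (\<lambda>s. p (t i + s * (t (Suc i) - t i))) \<in> D1 \<or>
               (\<lambda>s. p (t i + s * (t (Suc i) - t i))) \<in> D2))"

end

theory Submission
  imports Defs
begin

text \<open>
  On all points the square of fundamental categories is a pushout: a dipath is cut into \<open>N\<close> equal
  pieces each lying in \<open>X1\<close> or \<open>X2\<close>, and a cocone is evaluated piece by piece. Uniform subdivisions
  with \<open>N\<close> and \<open>M\<close> pieces share the refinement with \<open>N * M\<close> pieces, so the value does not depend on
  \<open>N\<close>, and an \<open>N \<times> N\<close> grid on a directed homotopy shows that it only depends on the class.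
  For \<open>B\<close> one precomposes the cocone with the retracts \<open>Q\<close>, for \<open>A\<close> with the composites of \<open>P\<close> and \<open>Q\<close>.
  Naturality of the units makes the retracts glue to a retract on \<open>X\<close>, which gives uniqueness:
  both squares are retracts of the pushout square on all points. Pushouts in the arrow category are
  computed levelwise, the compatibility of the two mediating functors being another instance of
  uniqueness.
\<close>

section \<open>Directed homotopies and directed squares\<close>

text \<open>Two obstacles shape the proof. The cut points of a dipath between points of
  \<open>A\<close> need not lie in \<open>A\<close>, so small dipaths generate the category on all
  points of \<open>X\<close>, while in a full subcategory the factors are not even arrows. A retract
  moves the cut points into \<open>A\<close> and fixes every arrow that already starts and ends
  there; this is how statements about generators reach the subcategories. The other obstacle is
  direction. A directed homotopy is monotone in its deformation parameter, so straight-line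
  homotopies exist only between comparable paths. One fact replaces them: monotone paths in a
  directed square with common endpoints have equivalent images. Applied to a square that is constant
  in one coordinate it yields reparametrization, hence associativity, units and splitting; applied
  to the two halves of a boundary it yields the relation contributed by a grid cell.\<close>

definition path2 :: "(real \<Rightarrow> real \<times> real) \<Rightarrow> bool" where
  "path2 \<gamma> \<longleftrightarrow> continuous_on {0..1} \<gamma> \<and> \<gamma> ` {0..1} \<subseteq> {0..1} \<times> {0..1} \<and>
     mono_on {0..1} (fst \<circ> \<gamma>) \<and> mono_on {0..1} (snd \<circ> \<gamma>)"

text \<open>A d-map from the directed square to \<open>Y\<close>; the dipaths of that square are
  given by \<open>path2\<close>. The boundary conditions of a homotopy are left out, so that grid
  cells are covered too.\<close>

definition dsquare :: "'a topology \<Rightarrow> (real \<Rightarrow> 'a) set \<Rightarrow> 'a set \<Rightarrow> (real \<times> real \<Rightarrow> 'a) \<Rightarrow> bool" where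
  "dsquare T D Y K \<longleftrightarrow>
     continuous_map (top_of_set ({0..1} \<times> {0..1})) (subtopology T Y) K \<and>
     (\<forall>\<gamma>. path2 \<gamma> \<longrightarrow> K \<circ> \<gamma> \<in> D)"

definition subpath_of :: "(real \<Rightarrow> 'a) \<Rightarrow> real \<Rightarrow> real \<Rightarrow> real \<Rightarrow> 'a" where
  "subpath_of p a b = (\<lambda>s. p (a + s * (b - a)))"

lemma affine_unit_bounds:
  fixes a b s :: real
  assumes "a \<le> b" "0 \<le> s" "s \<le> 1"
  shows "a \<le> a + s * (b - a)" "a + s * (b - a) \<le> b"
proof -
  have "0 \<le> s * (b - a)" "s * (b - a) \<le> 1 * (b - a)"
    using assms by (intro mult_right_mono mult_nonneg_nonneg; simp)+
  then show "a \<le> a + s * (b - a)" "a + s * (b - a) \<le> b" by auto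
qed

text \<open>Raising \<open>s\<close> first uses \<open>x \<le> y\<close>; raising \<open>x\<close>
  and \<open>y\<close> afterwards uses that both weights are nonnegative. This makes straight-line
  deformations monotone in both parameters, and \<open>x \<le> y\<close> is why the paths being
  joined must be comparable.\<close>

lemma affine_mono_both:
  fixes s s' x x' y y' :: real
  assumes "0 \<le> s" "s \<le> s'" "s' \<le> 1" "x \<le> x'" "y \<le> y'" "x \<le> y"
  shows "(1 - s) * x + s * y \<le> (1 - s') * x' + s' * y'"
proof -
  have "(1 - s) * x + s * y = x + s * (y - x)" by (simp add: algebra_simps)
  also have "\<dots> \<le> x + s' * (y - x)" using assms by (simp add: mult_right_mono)
  also have "\<dots> = (1 - s') * x + s' * y" by (simp add: algebra_simps)
  also have "\<dots> \<le> (1 - s') * x' + s' * y'" using assms by (intro add_mono mult_left_mono) auto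
  finally show ?thesis .
qed

lemma dihomotopic_iff:
  "dihomotopic T D Y p q \<longleftrightarrow> p \<in> dipaths D Y \<and> q \<in> dipaths D Y \<and>
     (\<exists>H. dsquare T D Y H \<and> (\<forall>t\<in>{0..1}. H (0, t) = p t \<and> H (1, t) = q t) \<and>
        (\<forall>s\<in>{0..1}. H (s, 0) = p 0 \<and> H (s, 1) = p 1))"
  unfolding dihomotopic_def dsquare_def path2_def by blast

lemma dhrel_refl [simp]: "(p, p) \<in> dhrel T D Y"
  by (simp add: dhrel_def)

lemma dhrel_sym: "(p, q) \<in> dhrel T D Y \<Longrightarrow> (q, p) \<in> dhrel T D Y"
  unfolding dhrel_def by (rule symD[OF sym_rtrancl]) (auto simp: sym_def)

lemma dhrel_trans: "(p, q) \<in> dhrel T D Y \<Longrightarrow> (q, r) \<in> dhrel T D Y \<Longrightarrow> (p, r) \<in> dhrel T D Y"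
  unfolding dhrel_def by (rule rtrancl_trans)

lemma dihomotopic_dhrel: "dihomotopic T D Y p q \<Longrightarrow> (p, q) \<in> dhrel T D Y"
  unfolding dhrel_def by (rule r_into_rtrancl) auto

lemma dhrel_induct [consumes 1, case_names refl step]:
  assumes "(p, q) \<in> dhrel T D Y"
    and "\<And>p. R p p"
    and "\<And>p q r. R p q \<Longrightarrow> dihomotopic T D Y q r \<or> dihomotopic T D Y r q \<Longrightarrow> R p r"
  shows "R p q"
  using assms(1) unfolding dhrel_def
  by (induction rule: rtrancl_induct) (use assms(2,3) in auto)

lemma dihomotopic_ends:
  assumes "dihomotopic T D Y p q"
  shows "p \<in> dipaths D Y" "q \<in> dipaths D Y" "q 0 = p 0" "q 1 = p 1"
proof -
  from assms obtain H where H: "\<forall>t\<in>{0..1::real}. H (0::real, t) = p t \<and> H (1, t) = q t"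
    "\<forall>s\<in>{0..1}. H (s, 0) = p 0 \<and> H (s, 1) = p 1"
    unfolding dihomotopic_iff by auto
  then show "q 0 = p 0" "q 1 = p 1"
    by (metis atLeastAtMost_iff order_refl zero_le_one)+
qed (use assms in \<open>auto simp: dihomotopic_iff\<close>)

lemma dhrel_ends:
  assumes "(p, q) \<in> dhrel T D Y"
  shows "q \<in> dipaths D Y \<longleftrightarrow> p \<in> dipaths D Y" "q 0 = p 0" "q 1 = p 1"
proof -
  have "(q \<in> dipaths D Y \<longleftrightarrow> p \<in> dipaths D Y) \<and> q 0 = p 0 \<and> q 1 = p 1"
    using assms
    by (induction rule: dhrel_induct) (auto dest: dihomotopic_ends)
  then show "q \<in> dipaths D Y \<longleftrightarrow> p \<in> dipaths D Y" "q 0 = p 0" "q 1 = p 1" by auto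
qed

lemma dclass_eq_iff: "dclass T D Y p = dclass T D Y q \<longleftrightarrow> (p, q) \<in> dhrel T D Y"
  unfolding dclass_def by (auto intro: dhrel_sym dhrel_trans)

text \<open>\<open>Comp\<close> and \<open>incl\<close> choose representatives by
  \<open>SOME\<close>. This is the way back from the chosen representative to the given one.\<close>

lemma some_dclass: "(p, SOME q. q \<in> dclass T D Y p) \<in> dhrel T D Y"
proof -
  have "(SOME q. q \<in> dclass T D Y p) \<in> dclass T D Y p"
    by (rule someI[of _ p]) (simp add: dclass_def)
  then show ?thesis by (simp add: dclass_def)
qed

lemma dihomotopic_mono:
  assumes "dihomotopic T D Y p q" "Y \<subseteq> Z"
  shows "dihomotopic T D Z p q"
proof -
  have "dsquare T D Z H" if "dsquare T D Y H" for H
    using that assms(2) unfolding dsquare_def continuous_map_in_subtopology by blast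
  moreover have "dipaths D Y \<subseteq> dipaths D Z" using assms(2) by (auto simp: dipaths_def)
  ultimately show ?thesis using assms(1) unfolding dihomotopic_iff by blast
qed

lemma dhrel_mono:
  assumes "(p, q) \<in> dhrel T D Y" "Y \<subseteq> Z"
  shows "(p, q) \<in> dhrel T D Z"
  using assms(1)
proof (induction rule: dhrel_induct)
  case (step p q r)
  then have "(q, r) \<in> dhrel T D Z"
    using dihomotopic_mono[OF _ assms(2)] by (blast intro: dihomotopic_dhrel dhrel_sym)
  with step show ?case by (blast intro: dhrel_trans)
qed simp

lemma path2_bounds:
  assumes "path2 \<gamma>" "0 \<le> t" "t \<le> 1"
  shows "0 \<le> fst (\<gamma> t)" "fst (\<gamma> t) \<le> 1" "0 \<le> snd (\<gamma> t)" "snd (\<gamma> t) \<le> 1"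
proof -
  have "\<gamma> t \<in> {0..1} \<times> {0..1}"
    using assms unfolding path2_def by (meson atLeastAtMost_iff image_subset_iff)
  then show "0 \<le> fst (\<gamma> t)" "fst (\<gamma> t) \<le> 1" "0 \<le> snd (\<gamma> t)" "snd (\<gamma> t) \<le> 1"
    by (auto simp: mem_Times_iff)
qed

lemma path2_mono:
  assumes "path2 \<gamma>" "0 \<le> t" "t \<le> t'" "t' \<le> 1"
  shows "fst (\<gamma> t) \<le> fst (\<gamma> t')" "snd (\<gamma> t) \<le> snd (\<gamma> t')"
  using assms by (auto simp: path2_def mono_on_def)

lemma path2I:
  assumes "continuous_on {0..1} \<gamma>"
    and "\<And>t. 0 \<le> t \<Longrightarrow> t \<le> 1 \<Longrightarrow> 0 \<le> fst (\<gamma> t) \<and> fst (\<gamma> t) \<le> 1 \<and> 0 \<le> snd (\<gamma> t) \<and> snd (\<gamma> t) \<le> 1"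
    and "\<And>t t'. 0 \<le> t \<Longrightarrow> t \<le> t' \<Longrightarrow> t' \<le> 1 \<Longrightarrow> fst (\<gamma> t) \<le> fst (\<gamma> t') \<and> snd (\<gamma> t) \<le> snd (\<gamma> t')"
  shows "path2 \<gamma>"
proof -
  have "\<gamma> t \<in> {0..1} \<times> {0..1}" if "t \<in> {0..1}" for t
    using assms(2)[of t] that by (simp add: mem_Times_iff)
  then have "\<gamma> ` {0..1} \<subseteq> {0..1} \<times> {0..1}" by (rule image_subsetI)
  then show ?thesis using assms(1,3) unfolding path2_def mono_on_def by simp
qed

section \<open>Dipaths and homotopies inside a directed square\<close>

locale d_space =
  fixes T :: "'a topology" and D :: "(real \<Rightarrow> 'a) set"
  assumes dspace: "dspace T D"
begin

lemma D_continuous: "p \<in> D \<Longrightarrow> continuous_map (top_of_set {0..1}) T p"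
  and D_cong: "p \<in> D \<Longrightarrow> (\<And>t. 0 \<le> t \<Longrightarrow> t \<le> 1 \<Longrightarrow> q t = p t) \<Longrightarrow> q \<in> D"
  and D_const: "x \<in> topspace T \<Longrightarrow> (\<lambda>t. x) \<in> D"
  and D_reparam: "p \<in> D \<Longrightarrow> continuous_on {0..1} \<phi> \<Longrightarrow> \<phi> ` {0..1} \<subseteq> {0..1} \<Longrightarrow>
                    mono_on {0..1} \<phi> \<Longrightarrow> p \<circ> \<phi> \<in> D"
  and D_pconcat: "p \<in> D \<Longrightarrow> q \<in> D \<Longrightarrow> p 1 = q 0 \<Longrightarrow> pconcat p q \<in> D"
  using dspace unfolding dspace_def by auto

lemma D_subset_topspace: "p \<in> D \<Longrightarrow> 0 \<le> t \<Longrightarrow> t \<le> 1 \<Longrightarrow> p t \<in> topspace T"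
  using D_continuous[of p] by (auto simp: continuous_map_def Pi_iff)

lemma dipaths_topspace: "dipaths D (topspace T) = D"
  using D_subset_topspace by (auto simp: dipaths_def)

lemma dipaths_const: "x \<in> Y \<Longrightarrow> Y \<subseteq> topspace T \<Longrightarrow> (\<lambda>t. x) \<in> dipaths D Y"
  using D_const by (auto simp: dipaths_def)

lemma dipaths_pconcat:
  assumes "p \<in> dipaths D Y" "q \<in> dipaths D Y" "p 1 = q 0"
  shows "pconcat p q \<in> dipaths D Y"
  using assms D_pconcat by (auto simp: dipaths_def pconcat_def image_subset_iff)

lemma D_subpath_of:
  assumes "p \<in> D" "0 \<le> a" "a \<le> b" "b \<le> 1"
  shows "subpath_of p a b \<in> D"
proof -
  have "p \<circ> (\<lambda>s. a + s * (b - a)) \<in> D"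
  proof (rule D_reparam[OF assms(1)])
    show "(\<lambda>s. a + s * (b - a)) ` {0..1} \<subseteq> {0..1}"
      using affine_unit_bounds[OF assms(3)] assms by fastforce
    show "mono_on {0..1} (\<lambda>s. a + s * (b - a))"
      using assms by (auto simp: mono_on_def intro: mult_right_mono)
  qed (intro continuous_intros)
  then show ?thesis by (simp add: subpath_of_def comp_def)
qed

lemma dipaths_subpath_of:
  assumes "p \<in> D" "0 \<le> a" "a \<le> b" "b \<le> 1" "\<And>t. a \<le> t \<Longrightarrow> t \<le> b \<Longrightarrow> p t \<in> Y"
  shows "subpath_of p a b \<in> dipaths D Y"
  using D_subpath_of[OF assms(1-4)] affine_unit_bounds[OF assms(3)] assms(5)
  unfolding dipaths_def by (fastforce simp: subpath_of_def)

lemma dipaths_subpath_of':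
  assumes "p \<in> dipaths D Y" "0 \<le> a" "a \<le> b" "b \<le> 1"
  shows "subpath_of p a b \<in> dipaths D Y"
  using assms by (intro dipaths_subpath_of) (auto simp: dipaths_def)

text \<open>The d-space axioms only join at the parameter 1/2; a monotone change of speed moves the
  join to any \<open>c\<close>. It is needed where a path crosses the seam of two glued squares at a
  time that is not under control.\<close>

lemma D_join:
  assumes c: "0 \<le> c" "c \<le> 1" and "subpath_of p 0 c \<in> D" "subpath_of p c 1 \<in> D"
  shows "p \<in> D"
proof (cases "c = 0 \<or> c = 1")
  case True
  then show ?thesis using assms by (auto simp: subpath_of_def)
next
  case False
  then have c: "0 < c" "c < 1" using assms by auto
  \<comment> \<open>Takes \<open>[0,c]\<close> linearly onto \<open>[0,1/2]\<close> and
    \<open>[c,1]\<close> onto \<open>[1/2,1]\<close>. As a sum of two clipped ramps it is continuous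
    and monotone without a case distinction.\<close>
  define \<rho> where "\<rho> = (\<lambda>u. min 1 (u / c) / 2 + max 0 ((u - c) / (1 - c)) / 2)"
  have "pconcat (subpath_of p 0 c) (subpath_of p c 1) \<circ> \<rho> \<in> D"
  proof (rule D_reparam)
    show "pconcat (subpath_of p 0 c) (subpath_of p c 1) \<in> D"
      by (rule D_pconcat) (use assms in \<open>auto simp: subpath_of_def\<close>)
    show "continuous_on {0..1} \<rho>" unfolding \<rho>_def using c by (intro continuous_intros) auto
    show mono: "mono_on {0..1} \<rho>"
      unfolding \<rho>_def mono_on_def using c
      by (intro allI impI add_mono divide_right_mono min.mono max.mono) auto
    have "\<rho> 0 = 0" "\<rho> 1 = 1" using c by (auto simp: \<rho>_def max_def min_def field_simps)
    with mono show "\<rho> ` {0..1} \<subseteq> {0..1}"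
      by (auto simp: mono_on_def) (metis order_refl zero_le_one)+
  qed
  then show ?thesis
  proof (rule D_cong)
    fix t :: real assume t: "0 \<le> t" "t \<le> 1"
    show "p t = (pconcat (subpath_of p 0 c) (subpath_of p c 1) \<circ> \<rho>) t"
    proof (cases "t \<le> c")
      case True
      then have "min 1 (t / c) = t / c" "max 0 ((t - c) / (1 - c)) = 0"
        using c by (auto simp: min_def max_def field_simps)
      then have "\<rho> t = t / c / 2" by (simp add: \<rho>_def)
      then show ?thesis using True c by (simp add: pconcat_def subpath_of_def)
    next
      case False
      then have "min 1 (t / c) = 1" "max 0 ((t - c) / (1 - c)) = (t - c) / (1 - c)"
        using c by (auto simp: min_def max_def field_simps)
      then have r: "\<rho> t = 1/2 + (t - c) / (1 - c) / 2" by (simp add: \<rho>_def)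
      have "(t - c) / (1 - c) / 2 > 0" using False c by simp
      then have "\<not> \<rho> t \<le> 1/2" unfolding r not_le by (rule less_add_same_cancel1[THEN iffD2])
      moreover have "2 * \<rho> t - 1 = (t - c) / (1 - c)" unfolding r distrib_left
        using nonzero_mult_div_cancel_left[of 2 "(t - c) / (1 - c)"] by (simp del: divide_divide_eq_left)
      ultimately show ?thesis using c by (simp add: pconcat_def subpath_of_def)
    qed
  qed
qed

lemma dsquare_path2:
  assumes "dsquare T D Y K" "path2 \<gamma>"
  shows "K \<circ> \<gamma> \<in> dipaths D Y"
proof -
  have "K ` ({0..1} \<times> {0..1}) \<subseteq> Y"
    using assms(1) by (auto simp: dsquare_def continuous_map_in_subtopology)
  moreover have "\<gamma> ` {0..1} \<subseteq> {0..1} \<times> {0..1}" using assms(2) by (simp add: path2_def)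
  ultimately have "(K \<circ> \<gamma>) ` {0..1} \<subseteq> Y" by (metis image_comp image_mono order_trans)
  then show ?thesis using assms by (simp add: dsquare_def dipaths_def)
qed

lemma dipaths_cong:
  assumes "p \<in> dipaths D Y" "\<And>t. 0 \<le> t \<Longrightarrow> t \<le> 1 \<Longrightarrow> q t = p t"
  shows "q \<in> dipaths D Y"
  using assms D_cong[of p q] by (auto simp: dipaths_def image_subset_iff)

text \<open>The square is constant in the first coordinate. It turns facts about squares into facts
  about paths, both for reparametrization and for the existence of subdivisions.\<close>

lemma dsquare_of_dipath:
  assumes "p \<in> dipaths D Y"
  shows "dsquare T D Y (\<lambda>z. p (snd z))"
  unfolding dsquare_def
proof (intro conjI allI impI)
  have "continuous_map (top_of_set {0..1}) (subtopology T Y) p"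
    using assms D_continuous[of p] by (auto simp: dipaths_def continuous_map_in_subtopology)
  moreover have "continuous_map (top_of_set ({0..1} \<times> {0..1})) (top_of_set {0..1::real}) (snd :: real \<times> real \<Rightarrow> real)"
    by (auto intro: continuous_intros)
  ultimately show "continuous_map (top_of_set ({0..1} \<times> {0..1})) (subtopology T Y) (\<lambda>z::real \<times> real. p (snd z))"
    using continuous_map_compose[unfolded comp_def] by blast
next
  fix \<gamma> assume g: "path2 \<gamma>"
  have "p \<circ> (snd \<circ> \<gamma>) \<in> D"
  proof (rule D_reparam)
    show "p \<in> D" using assms by (simp add: dipaths_def)
    show "continuous_on {0..1} (snd \<circ> \<gamma>)"
      using g by (auto simp: path2_def comp_def intro: continuous_on_snd)
    show "(snd \<circ> \<gamma>) ` {0..1} \<subseteq> {0..1}" using path2_bounds[OF g] by auto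
    show "mono_on {0..1} (snd \<circ> \<gamma>)" using g by (simp add: path2_def)
  qed
  then show "(\<lambda>z. p (snd z)) \<circ> \<gamma> \<in> D" by (simp add: comp_def)
qed

lemma dsquare_comp:
  assumes K: "dsquare T D Y K"
    and cont: "continuous_on ({0..1} \<times> {0..1}) h"
    and range: "h ` ({0..1} \<times> {0..1}) \<subseteq> {0..1} \<times> {0..1}"
    and mono: "\<And>s s' t t'. 0 \<le> s \<Longrightarrow> s \<le> s' \<Longrightarrow> s' \<le> 1 \<Longrightarrow> 0 \<le> t \<Longrightarrow> t \<le> t' \<Longrightarrow> t' \<le> 1 \<Longrightarrow>
       fst (h (s, t)) \<le> fst (h (s', t')) \<and> snd (h (s, t)) \<le> snd (h (s', t'))"
  shows "dsquare T D Y (K \<circ> h)"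
  unfolding dsquare_def
proof (intro conjI allI impI)
  show "continuous_map (top_of_set ({0..1} \<times> {0..1})) (subtopology T Y) (K \<circ> h)"
    using K cont range unfolding dsquare_def
    by (intro continuous_map_compose[where X' = "top_of_set ({0..1} \<times> {0..1})"]) auto
next
  fix \<gamma> assume g: "path2 \<gamma>"
  have "path2 (h \<circ> \<gamma>)"
  proof (rule path2I)
    show "continuous_on {0..1} (h \<circ> \<gamma>)"
      using g cont unfolding path2_def by (blast intro: continuous_on_compose continuous_on_subset)
    show "0 \<le> fst ((h \<circ> \<gamma>) t) \<and> fst ((h \<circ> \<gamma>) t) \<le> 1 \<and> 0 \<le> snd ((h \<circ> \<gamma>) t) \<and> snd ((h \<circ> \<gamma>) t) \<le> 1"
      if "0 \<le> t" "t \<le> 1" for t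
    proof -
      have "\<gamma> t \<in> {0..1} \<times> {0..1}" using path2_bounds[OF g that] by (simp add: mem_Times_iff)
      then have "h (\<gamma> t) \<in> {0..1} \<times> {0..1}" by (rule subsetD[OF range imageI])
      then show ?thesis by (simp add: mem_Times_iff)
    qed
    show "fst ((h \<circ> \<gamma>) r) \<le> fst ((h \<circ> \<gamma>) r') \<and> snd ((h \<circ> \<gamma>) r) \<le> snd ((h \<circ> \<gamma>) r')"
      if r: "0 \<le> r" "r \<le> r'" "r' \<le> 1" for r r'
      using mono[of "fst (\<gamma> r)" "fst (\<gamma> r')" "snd (\<gamma> r)" "snd (\<gamma> r')"] path2_mono[OF g r]
        path2_bounds[OF g, of r] path2_bounds[OF g, of r'] r by simp
  qed
  then show "K \<circ> h \<circ> \<gamma> \<in> D" using K by (auto simp: dsquare_def comp_assoc)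
qed

text \<open>The homotopy is the convex combination of \<open>\<gamma>\<close> and
  \<open>\<gamma>'\<close> followed by \<open>K\<close>. Convexity keeps it in the square,
  \<open>le\<close> makes it monotone in the deformation parameter, and the common endpoints stay
  fixed.\<close>

lemma dsquare_dihomotopic:
  assumes K: "dsquare T D Y K" and g: "path2 \<gamma>" and g': "path2 \<gamma>'"
    and le: "\<And>t. 0 \<le> t \<Longrightarrow> t \<le> 1 \<Longrightarrow> fst (\<gamma> t) \<le> fst (\<gamma>' t) \<and> snd (\<gamma> t) \<le> snd (\<gamma>' t)"
    and ends: "\<gamma> 0 = \<gamma>' 0" "\<gamma> 1 = \<gamma>' 1"
    and f: "\<And>t. 0 \<le> t \<Longrightarrow> t \<le> 1 \<Longrightarrow> f t = K (\<gamma> t)"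
    and f': "\<And>t. 0 \<le> t \<Longrightarrow> t \<le> 1 \<Longrightarrow> f' t = K (\<gamma>' t)"
  shows "dihomotopic T D Y f f'"
proof -
  define h where "h = (\<lambda>z::real \<times> real. ((1 - fst z) * fst (\<gamma> (snd z)) + fst z * fst (\<gamma>' (snd z)),
                           (1 - fst z) * snd (\<gamma> (snd z)) + fst z * snd (\<gamma>' (snd z))))"
  have conv: "0 \<le> (1 - s) * x + s * y" "(1 - s) * x + s * y \<le> 1"
    if "0 \<le> s" "s \<le> 1" "0 \<le> x" "x \<le> 1" "0 \<le> y" "y \<le> 1" for s x y :: real
    using that convex_bound_le[of x 1 y "1 - s" s] by auto
  have "dsquare T D Y (K \<circ> h)"
  proof (rule dsquare_comp[OF K])
    have "continuous_on ({0..1} \<times> {0..1}) (\<lambda>z::real \<times> real. \<delta> (snd z))" if "path2 \<delta>" for \<delta>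
      using that unfolding path2_def
      by (intro continuous_on_compose2[where g = \<delta> and f = snd] continuous_intros) auto
    note this[OF g] this[OF g']
    then show "continuous_on ({0..1} \<times> {0..1}) h"
      unfolding h_def by (intro continuous_intros)
    show "h ` ({0..1} \<times> {0..1}) \<subseteq> {0..1} \<times> {0..1}"
      unfolding h_def using path2_bounds[OF g] path2_bounds[OF g'] by (auto intro!: conv)
    fix s s' t t' :: real
    assume "0 \<le> s" "s \<le> s'" "s' \<le> 1" "0 \<le> t" "t \<le> t'" "t' \<le> 1"
    then show "fst (h (s, t)) \<le> fst (h (s', t')) \<and> snd (h (s, t)) \<le> snd (h (s', t'))"
      unfolding h_def using path2_mono[OF g, of t t'] path2_mono[OF g', of t t'] le[of t]
      by (auto intro!: affine_mono_both)
  qed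
  moreover have "f \<in> dipaths D Y" "f' \<in> dipaths D Y"
    using dsquare_path2[OF K g] dsquare_path2[OF K g'] dipaths_cong f f' by (auto simp: comp_def)
  moreover have "h (s, t) = \<gamma> t" if "\<gamma> t = \<gamma>' t" for s t
    using that by (simp add: h_def algebra_simps prod_eq_iff)
  moreover have "h (0, t) = \<gamma> t" "h (1, t) = \<gamma>' t" for t by (auto simp: h_def)
  ultimately show ?thesis
    unfolding dihomotopic_iff using f f' ends by (intro conjI exI[of _ "K \<circ> h"]) auto
qed

text \<open>Directed homotopies only move paths upwards; passing through the pointwise minimum
  makes any two monotone paths of the square comparable.\<close>

lemma dsquare_dhrel:
  assumes K: "dsquare T D Y K" and g: "path2 \<gamma>" and g': "path2 \<gamma>'"
    and ends: "\<gamma> 0 = \<gamma>' 0" "\<gamma> 1 = \<gamma>' 1"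
    and f: "\<And>t. 0 \<le> t \<Longrightarrow> t \<le> 1 \<Longrightarrow> f t = K (\<gamma> t)"
    and f': "\<And>t. 0 \<le> t \<Longrightarrow> t \<le> 1 \<Longrightarrow> f' t = K (\<gamma>' t)"
  shows "(f, f') \<in> dhrel T D Y"
proof -
  define \<mu> where "\<mu> = (\<lambda>t. (min (fst (\<gamma> t)) (fst (\<gamma>' t)), min (snd (\<gamma> t)) (snd (\<gamma>' t))))"
  have m: "path2 \<mu>"
  proof (rule path2I)
    show "continuous_on {0..1} \<mu>" using g g' unfolding \<mu>_def path2_def by (intro continuous_intros) auto
    show "0 \<le> fst (\<mu> t) \<and> fst (\<mu> t) \<le> 1 \<and> 0 \<le> snd (\<mu> t) \<and> snd (\<mu> t) \<le> 1"
      if "0 \<le> t" "t \<le> 1" for t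
      using path2_bounds[OF g that] path2_bounds[OF g' that] by (auto simp: \<mu>_def)
    show "fst (\<mu> t) \<le> fst (\<mu> t') \<and> snd (\<mu> t) \<le> snd (\<mu> t')"
      if "0 \<le> t" "t \<le> t'" "t' \<le> 1" for t t'
      using path2_mono[OF g that] path2_mono[OF g' that] unfolding \<mu>_def
      by (auto intro!: min.mono simp del: min.bounded_iff)
  qed
  have "dihomotopic T D Y (K \<circ> \<mu>) f"
    by (rule dsquare_dihomotopic[OF K m g]) (use ends f in \<open>auto simp: \<mu>_def\<close>)
  moreover have "dihomotopic T D Y (K \<circ> \<mu>) f'"
    by (rule dsquare_dihomotopic[OF K m g']) (use ends f' in \<open>auto simp: \<mu>_def\<close>)
  ultimately show ?thesis by (blast intro: dihomotopic_dhrel dhrel_sym dhrel_trans)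
qed

text \<open>Both reparametrizations are monotone paths on one vertical edge of the square constant
  in its first coordinate. They share their endpoints but need not be comparable, so this rests on
  \<open>dsquare_dhrel\<close> and not on a single homotopy.\<close>

lemma dhrel_reparam:
  assumes p: "p \<in> dipaths D Y"
    and \<phi>: "continuous_on {0..1} \<phi>" "mono_on {0..1} \<phi>"
    and \<psi>: "continuous_on {0..1} \<psi>" "mono_on {0..1} \<psi>"
    and ends: "\<phi> 0 = \<psi> 0" "\<phi> 1 = \<psi> 1" "0 \<le> \<phi> 0" "\<phi> 1 \<le> 1"
    and f: "\<And>t. 0 \<le> t \<Longrightarrow> t \<le> 1 \<Longrightarrow> f t = p (\<phi> t)"
    and f': "\<And>t. 0 \<le> t \<Longrightarrow> t \<le> 1 \<Longrightarrow> f' t = p (\<psi> t)"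
  shows "(f, f') \<in> dhrel T D Y"
proof (rule dsquare_dhrel[OF dsquare_of_dipath[OF p]])
  have aux: "path2 (\<lambda>t. (0, \<xi> t))"
    if "continuous_on {0..1} \<xi>" "mono_on {0..1} \<xi>" "0 \<le> \<xi> 0" "\<xi> 1 \<le> 1" for \<xi> :: "real \<Rightarrow> real"
  proof (rule path2I)
    show "continuous_on {0..1} (\<lambda>t. (0::real, \<xi> t))" using that(1) by (intro continuous_intros)
    fix t :: real assume "0 \<le> t" "t \<le> 1"
    then have "\<xi> 0 \<le> \<xi> t" "\<xi> t \<le> \<xi> 1" using that(2) by (auto simp: mono_on_def)
    then show "0 \<le> fst (0::real, \<xi> t) \<and> fst (0::real, \<xi> t) \<le> 1 \<and> 0 \<le> snd (0::real, \<xi> t) \<and> snd (0::real, \<xi> t) \<le> 1"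
      using that by auto
  qed (use that in \<open>auto simp: mono_on_def\<close>)
  show "path2 (\<lambda>t. (0, \<phi> t))" "path2 (\<lambda>t. (0, \<psi> t))" using aux \<phi> \<psi> ends by auto
qed (use ends f f' in auto)

end

section \<open>The fundamental category\<close>

definition darrow :: "'a topology \<Rightarrow> (real \<Rightarrow> 'a) set \<Rightarrow> 'a set \<Rightarrow> (real \<Rightarrow> 'a) \<Rightarrow> 'a darr" where
  "darrow T D Y p = (p 0, p 1, dclass T D Y p)"

lemma fcat_simps [simp]:
  "Obj (fcat T D Y A) = A" "Dom (fcat T D Y A) f = fst f" "Cod (fcat T D Y A) f = fst (snd f)"
  "Id (fcat T D Y A) a = darrow T D Y (\<lambda>t. a)"
  by (simp_all add: fcat_def darrow_def)

lemma darrow_ends [simp]: "fst (darrow T D Y p) = p 0" "fst (snd (darrow T D Y p)) = p 1"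
  by (simp_all add: darrow_def)

lemma Arr_fcat: "Arr (fcat T D Y A) = {darrow T D Y p | p. p \<in> dipaths D Y \<and> p 0 \<in> A \<and> p 1 \<in> A}"
  by (simp add: fcat_def darrow_def)

lemma Arr_fcatE:
  assumes "f \<in> Arr (fcat T D Y A)"
  obtains p where "f = darrow T D Y p" "p \<in> dipaths D Y" "p 0 \<in> A" "p 1 \<in> A"
  using assms unfolding Arr_fcat by blast

lemma darrow_in_Arr:
  "p \<in> dipaths D Y \<Longrightarrow> p 0 \<in> A \<Longrightarrow> p 1 \<in> A \<Longrightarrow> darrow T D Y p \<in> Arr (fcat T D Y A)"
  unfolding Arr_fcat by blast

lemma dipaths_ends: "p \<in> dipaths D Y \<Longrightarrow> p 0 \<in> Y \<and> p 1 \<in> Y"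
  by (auto simp: dipaths_def)

lemma darrow_eqI: "(p, q) \<in> dhrel T D Y \<Longrightarrow> darrow T D Y p = darrow T D Y q"
  using dhrel_ends[of p q T D Y] by (simp add: darrow_def dclass_eq_iff)

lemma FObj_incl [simp]: "FObj (incl T D Y) = id"
  by (simp add: incl_def)

lemma FArr_incl [simp]: "Y \<subseteq> Z \<Longrightarrow> FArr (incl T D Z) (darrow T D Y p) = darrow T D Z p"
  using dhrel_mono[OF some_dclass[of p T D Y], of Z]
  by (simp add: incl_def darrow_def dclass_eq_iff dhrel_sym)

lemma path2_subpath_of:
  assumes g: "path2 \<gamma>" and ab: "0 \<le> a" "a \<le> b" "b \<le> 1"
  shows "path2 (subpath_of \<gamma> a b)"
proof (rule path2I)
  note bd = affine_unit_bounds[OF ab(2)]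
  have "(\<lambda>s. a + s * (b - a)) ` {0..1} \<subseteq> {0..1}"
    using bd ab by fastforce
  moreover have "continuous_on {0..1} \<gamma>" using g by (simp add: path2_def)
  moreover have "continuous_on {0..1} (\<lambda>s. a + s * (b - a))" by (intro continuous_intros)
  ultimately show "continuous_on {0..1} (subpath_of \<gamma> a b)"
    unfolding subpath_of_def by (metis continuous_on_compose2)
  show "0 \<le> fst (subpath_of \<gamma> a b t) \<and> fst (subpath_of \<gamma> a b t) \<le> 1 \<and>
        0 \<le> snd (subpath_of \<gamma> a b t) \<and> snd (subpath_of \<gamma> a b t) \<le> 1" if "0 \<le> t" "t \<le> 1" for t
    unfolding subpath_of_def
    using path2_bounds[OF g, of "a + t * (b - a)"] order_trans[OF ab(1) bd(1)[OF that]]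
      order_trans[OF bd(2)[OF that] ab(3)] by blast
  show "fst (subpath_of \<gamma> a b t) \<le> fst (subpath_of \<gamma> a b t') \<and>
        snd (subpath_of \<gamma> a b t) \<le> snd (subpath_of \<gamma> a b t')" if "0 \<le> t" "t \<le> t'" "t' \<le> 1" for t t'
  proof -
    have "0 \<le> a + t * (b - a)" "a + t' * (b - a) \<le> 1" "a + t * (b - a) \<le> a + t' * (b - a)"
      using order_trans[OF ab(1) bd(1)[of t]] order_trans[OF bd(2)[of t'] ab(3)] that ab
      by (auto intro: mult_right_mono)
    then show ?thesis unfolding subpath_of_def using path2_mono[OF g] by blast
  qed
qed

section \<open>Concatenations as explicit reparametrizations\<close>

lemma pconcat_const_left: "0 \<le> t \<Longrightarrow> pconcat (\<lambda>t. p 0) p t = p (max 0 (2 * t - 1))"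
  and pconcat_const_right: "t \<le> 1 \<Longrightarrow> pconcat p (\<lambda>t. p 1) t = p (min 1 (2 * t))"
  by (rule linorder_cases[of t "1/2"]; hypsubst?; simp add: pconcat_def)+

text \<open>The reparametrization that changes the bracketing has slopes 2, 1 and 1/2 with breaks at
  1/4 and 1/2. The slopes decrease, so it is concave and equals the minimum of its three affine
  pieces, which makes continuity and monotonicity immediate.\<close>

lemma pconcat_assoc:
  assumes "p 1 = q 0" "q 1 = r 0"
  shows "pconcat (pconcat p q) r t =
         pconcat p (pconcat q r) (min (2 * t) (min (t + 1/4) (t/2 + 1/2)))"
proof -
  consider "t \<le> 1/4" | "1/4 < t" "t \<le> 1/2" | "1/2 < t" by linarith
  then show ?thesis
  proof cases
    case 1
    then have "min (2 * t) (min (t + 1/4) (t/2 + 1/2)) = 2 * t" by linarith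
    with 1 show ?thesis by (simp add: pconcat_def)
  next
    case 2
    then have "min (2 * t) (min (t + 1/4) (t/2 + 1/2)) = t + 1/4" by linarith
    with 2 show ?thesis by (simp add: pconcat_def algebra_simps)
  next
    case 3
    then have "min (2 * t) (min (t + 1/4) (t/2 + 1/2)) = t/2 + 1/2" by linarith
    with 3 show ?thesis by (simp add: pconcat_def algebra_simps)
  qed
qed

lemma pconcat_subpath_of:
  "pconcat (subpath_of p a b) (subpath_of p b c) t =
     p (a + min 1 (2 * t) * (b - a) + max 0 (2 * t - 1) * (c - b))"
  by (rule linorder_cases[of t "1/2"]; hypsubst?; simp add: pconcat_def subpath_of_def)

lemma subpath_of_subpath_of:
  "subpath_of (subpath_of p a b) u v = subpath_of p (a + u * (b - a)) (a + v * (b - a))"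
  by (auto simp: subpath_of_def algebra_simps)

lemma subpath_of_0_1 [simp]: "subpath_of p 0 1 = p"
  by (simp add: subpath_of_def)

lemma pconcat_first_half: "x \<le> 1 \<Longrightarrow> pconcat p q (x / 2) = p x"
  and pconcat_second_half: "0 \<le> x \<Longrightarrow> p 1 = q 0 \<Longrightarrow> pconcat p q (1/2 + x / 2) = q x"
  by (auto simp: pconcat_def)

lemma pconcat_ends [simp]: "pconcat p q 0 = p 0" "pconcat p q 1 = q 1"
  by (simp_all add: pconcat_def)

section \<open>Concatenation of homotopies and the category laws\<close>

context d_space
begin

lemma dihomotopic_refl:
  assumes "p \<in> dipaths D Y"
  shows "dihomotopic T D Y p p"
  unfolding dihomotopic_iff using dsquare_of_dipath[OF assms] assms
  by (intro conjI exI[of _ "\<lambda>z. p (snd z)"]) auto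

text \<open>Continuity is a gluing along \<open>snd z = 1/2\<close>. The directed part must handle a
  monotone path that crosses this seam: its second coordinate is monotone, so the path splits into
  one part below the seam and one above, and comparing with 1/2 at one end of each part is
  enough.\<close>

lemma dsquare_pconcat:
  assumes H: "dsquare T D Y H" and K: "dsquare T D Y K"
    and HK: "\<And>s. 0 \<le> s \<Longrightarrow> s \<le> 1 \<Longrightarrow> H (s, 1) = K (s, 0)"
  shows "dsquare T D Y (\<lambda>z. if snd z \<le> 1/2 then H (fst z, 2 * snd z) else K (fst z, 2 * snd z - 1))"
    (is "dsquare T D Y ?L")
  unfolding dsquare_def
proof (intro conjI allI impI)
  let ?S = "{0..1} \<times> {0..1} :: (real \<times> real) set"
  show "continuous_map (top_of_set ?S) (subtopology T Y) ?L"
  proof (rule continuous_map_cases_le)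
    have *: "continuous_map (subtopology (top_of_set ?S) {x \<in> topspace (top_of_set ?S). snd x \<le> 1/2})
        (top_of_set ?S) (\<lambda>z. (fst z, 2 * snd z))"
      by (auto simp: subtopology_subtopology intro!: continuous_intros)
    show "continuous_map (subtopology (top_of_set ?S) {x \<in> topspace (top_of_set ?S). snd x \<le> 1/2})
        (subtopology T Y) (\<lambda>z. H (fst z, 2 * snd z))"
      using continuous_map_compose[OF *, of "subtopology T Y" H] H by (simp add: dsquare_def comp_def)
    have *: "continuous_map (subtopology (top_of_set ?S) {x \<in> topspace (top_of_set ?S). 1/2 \<le> snd x})
        (top_of_set ?S) (\<lambda>z. (fst z, 2 * snd z - 1))"
      by (auto simp: subtopology_subtopology intro!: continuous_intros)
    show "continuous_map (subtopology (top_of_set ?S) {x \<in> topspace (top_of_set ?S). 1/2 \<le> snd x})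
        (subtopology T Y) (\<lambda>z. K (fst z, 2 * snd z - 1))"
      using continuous_map_compose[OF *, of "subtopology T Y" K] K by (simp add: dsquare_def comp_def)
    show "H (fst z, 2 * snd z) = K (fst z, 2 * snd z - 1)"
      if "z \<in> topspace (top_of_set ?S)" "snd z = 1/2" for z
      unfolding that(2) using that(1) HK by (simp add: mem_Times_iff)
  qed (auto intro!: continuous_intros)
next
  fix \<gamma> assume g: "path2 \<gamma>"
  note [continuous_intros] = continuous_on_fst continuous_on_snd
  have low: "subpath_of (?L \<circ> \<gamma>) a b \<in> D"
    if ab: "0 \<le> a" "a \<le> b" "b \<le> 1" and le: "snd (\<gamma> b) \<le> 1/2" for a b
  proof -
    let ?\<delta> = "subpath_of \<gamma> a b"
    have d: "path2 ?\<delta>" by (rule path2_subpath_of[OF g ab])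
    have half: "snd (?\<delta> t) \<le> 1/2" if "0 \<le> t" "t \<le> 1" for t
      using path2_mono(2)[OF d that(1,2)] le by (simp add: subpath_of_def)
    have "path2 (\<lambda>t. (fst (?\<delta> t), 2 * snd (?\<delta> t)))"
    proof (rule path2I)
      show "continuous_on {0..1} (\<lambda>t. (fst (?\<delta> t), 2 * snd (?\<delta> t)))"
        using d unfolding path2_def by (intro continuous_intros) auto
    qed (use half path2_bounds[OF d] path2_mono[OF d] in \<open>auto simp: mult.commute[of 2]\<close>)
    then have "H \<circ> (\<lambda>t. (fst (?\<delta> t), 2 * snd (?\<delta> t))) \<in> D" using H by (simp add: dsquare_def)
    then show ?thesis by (rule D_cong) (use half in \<open>auto simp: subpath_of_def\<close>)
  qed
  have high: "subpath_of (?L \<circ> \<gamma>) a b \<in> D"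
    if ab: "0 \<le> a" "a \<le> b" "b \<le> 1" and le: "1/2 \<le> snd (\<gamma> a)" for a b
  proof -
    let ?\<delta> = "subpath_of \<gamma> a b"
    have d: "path2 ?\<delta>" by (rule path2_subpath_of[OF g ab])
    have half: "1/2 \<le> snd (?\<delta> t)" if "0 \<le> t" "t \<le> 1" for t
      using path2_mono(2)[OF d _ that(1,2)] le by (simp add: subpath_of_def)
    have "path2 (\<lambda>t. (fst (?\<delta> t), 2 * snd (?\<delta> t) - 1))"
    proof (rule path2I)
      show "continuous_on {0..1} (\<lambda>t. (fst (?\<delta> t), 2 * snd (?\<delta> t) - 1))"
        using d unfolding path2_def by (intro continuous_intros) auto
    qed (use half path2_bounds[OF d] path2_mono[OF d] in \<open>auto simp: mult.commute[of 2]\<close>)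
    then have "K \<circ> (\<lambda>t. (fst (?\<delta> t), 2 * snd (?\<delta> t) - 1)) \<in> D" using K by (simp add: dsquare_def)
    then show ?thesis
    proof (rule D_cong)
      fix t :: real assume t: "0 \<le> t" "t \<le> 1"
      have "?L (?\<delta> t) = K (fst (?\<delta> t), 2 * snd (?\<delta> t) - 1)"
      proof (cases "snd (?\<delta> t) \<le> 1/2")
        case True
        then have "snd (?\<delta> t) = 1/2" using half[OF t] by simp
        then show ?thesis unfolding \<open>snd (?\<delta> t) = 1/2\<close> using HK path2_bounds[OF d t] by simp
      qed simp
      then show "subpath_of (?L \<circ> \<gamma>) a b t = (K \<circ> (\<lambda>t. (fst (?\<delta> t), 2 * snd (?\<delta> t) - 1))) t"
        by (simp only: subpath_of_def comp_def)
    qed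
  qed
  consider "snd (\<gamma> 1) \<le> 1/2" | "1/2 \<le> snd (\<gamma> 0)" | "snd (\<gamma> 0) \<le> 1/2" "1/2 \<le> snd (\<gamma> 1)"
    by linarith
  then show "?L \<circ> \<gamma> \<in> D"
  proof cases
    case 1
    then show ?thesis using low[of 0 1] by simp
  next
    case 2
    then show ?thesis using high[of 0 1] by simp
  next
    case 3
    \<comment> \<open>The intermediate value theorem supplies the crossing time
      \<open>c\<close>.\<close>
    have "continuous_on {0..1} (\<lambda>t. snd (\<gamma> t))" using g by (simp add: path2_def continuous_on_snd)
    then obtain c where c: "0 \<le> c" "c \<le> 1" "snd (\<gamma> c) = 1/2"
      using IVT'[of "\<lambda>t. snd (\<gamma> t)" 0 "1/2" 1] 3 by auto
    show ?thesis
    proof (rule D_join[OF c(1,2)])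
      show "subpath_of (?L \<circ> \<gamma>) 0 c \<in> D" by (rule low) (use c in simp_all)
      show "subpath_of (?L \<circ> \<gamma>) c 1 \<in> D" by (rule high) (use c in simp_all)
    qed
  qed
qed

lemma dihomotopic_pconcat:
  assumes "dihomotopic T D Y p p'" "dihomotopic T D Y q q'" "p 1 = q 0"
  shows "dihomotopic T D Y (pconcat p q) (pconcat p' q')"
proof -
  obtain H where H: "dsquare T D Y H" "\<forall>t\<in>{0..1}. H (0, t) = p t \<and> H (1, t) = p' t"
      "\<forall>s\<in>{0..1}. H (s, 0) = p 0 \<and> H (s, 1) = p 1"
    using assms(1) unfolding dihomotopic_iff by blast
  obtain K where K: "dsquare T D Y K" "\<forall>t\<in>{0..1}. K (0, t) = q t \<and> K (1, t) = q' t"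
      "\<forall>s\<in>{0..1}. K (s, 0) = q 0 \<and> K (s, 1) = q 1"
    using assms(2) unfolding dihomotopic_iff by blast
  note ends = dihomotopic_ends[OF assms(1)] dihomotopic_ends[OF assms(2)]
  have "dsquare T D Y (\<lambda>z. if snd z \<le> 1/2 then H (fst z, 2 * snd z) else K (fst z, 2 * snd z - 1))"
    by (rule dsquare_pconcat) (use H K assms(3) in auto)
  then show ?thesis unfolding dihomotopic_iff using H K ends assms(3)
    by (intro conjI dipaths_pconcat exI) (auto simp: pconcat_def)
qed

text \<open>One factor is moved at a time while the other stays under the constant homotopy. The
  matching of endpoints is part of both inductions, because each single step can only be glued when
  they match.\<close>

lemma dhrel_pconcat:
  assumes "(p, p') \<in> dhrel T D Y" "(q, q') \<in> dhrel T D Y"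
    and p: "p \<in> dipaths D Y" and q: "q \<in> dipaths D Y" and pq: "p 1 = q 0"
  shows "(pconcat p q, pconcat p' q') \<in> dhrel T D Y"
proof -
  have "p 1 = q 0 \<longrightarrow> p' 1 = q 0 \<and> (pconcat p q, pconcat p' q) \<in> dhrel T D Y"
    using assms(1)
  proof (induction rule: dhrel_induct)
    case (step p p' r)
    then have "p' 1 = q 0 \<longrightarrow> r 1 = q 0 \<and> (pconcat p' q, pconcat r q) \<in> dhrel T D Y"
      using dihomotopic_pconcat[OF _ dihomotopic_refl[OF q]] dihomotopic_ends(4)
      by (metis dhrel_sym dihomotopic_dhrel)
    with step(1) show ?case by (blast intro: dhrel_trans)
  qed simp
  then have 1: "p' 1 = q 0" "(pconcat p q, pconcat p' q) \<in> dhrel T D Y" using pq by auto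
  have p': "p' \<in> dipaths D Y" using dhrel_ends[OF assms(1)] p by simp
  have "p' 1 = q 0 \<longrightarrow> p' 1 = q' 0 \<and> (pconcat p' q, pconcat p' q') \<in> dhrel T D Y"
    using assms(2)
  proof (induction rule: dhrel_induct)
    case (step q q' r)
    then have "p' 1 = q' 0 \<longrightarrow> p' 1 = r 0 \<and> (pconcat p' q', pconcat p' r) \<in> dhrel T D Y"
      using dihomotopic_pconcat[OF dihomotopic_refl[OF p']] dihomotopic_ends(3)
      by (metis dhrel_sym dihomotopic_dhrel)
    with step(1) show ?case by (blast intro: dhrel_trans)
  qed simp
  with 1 show ?thesis by (blast intro: dhrel_trans)
qed

lemma dhrel_pconcat_assoc:
  assumes "p \<in> dipaths D Y" "q \<in> dipaths D Y" "r \<in> dipaths D Y" "p 1 = q 0" "q 1 = r 0"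
  shows "(pconcat (pconcat p q) r, pconcat p (pconcat q r)) \<in> dhrel T D Y"
proof (rule dhrel_reparam)
  show "pconcat p (pconcat q r) \<in> dipaths D Y" using assms by (intro dipaths_pconcat) auto
  show "mono_on {0..1} (\<lambda>t::real. min (2 * t) (min (t + 1/4) (t/2 + 1/2)))"
    unfolding mono_on_def by (intro allI impI min.mono) auto
  show "continuous_on {0..1} (\<lambda>t::real. min (2 * t) (min (t + 1/4) (t/2 + 1/2)))"
    by (intro continuous_intros) auto
  show "mono_on {0..1} (\<lambda>t::real. t)" by (simp add: mono_on_def)
qed (use assms in \<open>auto simp: pconcat_assoc\<close>)

lemma dhrel_pconcat_const:
  assumes "p \<in> dipaths D Y"
  shows "(pconcat (\<lambda>t. p 0) p, p) \<in> dhrel T D Y" "(pconcat p (\<lambda>t. p 1), p) \<in> dhrel T D Y"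
proof -
  have id: "mono_on {0..1} (\<lambda>t::real. t)" by (simp add: mono_on_def)
  show "(pconcat (\<lambda>t. p 0) p, p) \<in> dhrel T D Y"
  proof (rule dhrel_reparam[OF assms _ _ _ id])
    show "mono_on {0..1} (\<lambda>t::real. max 0 (2 * t - 1))"
      unfolding mono_on_def by (intro allI impI max.mono) auto
    show "continuous_on {0..1} (\<lambda>t::real. max 0 (2 * t - 1))" by (intro continuous_intros)
  qed (auto simp: pconcat_const_left)
  show "(pconcat p (\<lambda>t. p 1), p) \<in> dhrel T D Y"
  proof (rule dhrel_reparam[OF assms _ _ _ id])
    show "mono_on {0..1} (\<lambda>t::real. min 1 (2 * t))"
      unfolding mono_on_def by (intro allI impI min.mono) auto
    show "continuous_on {0..1} (\<lambda>t::real. min 1 (2 * t))" by (intro continuous_intros)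
  qed (auto simp: pconcat_const_right)
qed

lemma dhrel_split:
  assumes p: "p \<in> dipaths D Y" and c: "0 \<le> c" "c \<le> 1"
  shows "(pconcat (subpath_of p 0 c) (subpath_of p c 1), p) \<in> dhrel T D Y"
proof (rule dhrel_reparam[OF p])
  show "mono_on {0..1} (\<lambda>t. 0 + min 1 (2 * t) * (c - 0) + max 0 (2 * t - 1) * (1 - c))"
    unfolding mono_on_def using c
    by (intro allI impI add_mono mult_right_mono min.mono max.mono order_refl) auto
  show "continuous_on {0..1} (\<lambda>t. 0 + min 1 (2 * t) * (c - 0) + max 0 (2 * t - 1) * (1 - c))"
    by (intro continuous_intros)
  show "mono_on {0..1} (\<lambda>t::real. t)" by (simp add: mono_on_def)
qed (simp_all add: pconcat_subpath_of)

text \<open>Only the piece over \<open>[a,c]\<close> is assumed to be a dipath in \<open>Y\<close>;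
  the rest of \<open>p\<close> may leave \<open>Y\<close>. Hence the split is made within that
  piece.\<close>

lemma dhrel_split_subpath_of:
  assumes "subpath_of p a c \<in> dipaths D Y" "a \<le> b" "b \<le> c"
  shows "(pconcat (subpath_of p a b) (subpath_of p b c), subpath_of p a c) \<in> dhrel T D Y"
    and "subpath_of p a b \<in> dipaths D Y" "subpath_of p b c \<in> dipaths D Y"
proof -
  \<comment> \<open>\<open>u\<close> is the relative position of \<open>b\<close> in
    \<open>[a,c]\<close>; for a degenerate interval 0 serves.\<close>
  obtain u where u: "0 \<le> u" "u \<le> 1" "b = a + u * (c - a)"
  proof (cases "a = c")
    case True
    then show ?thesis using assms that[of 0] by auto
  next
    case False
    then show ?thesis using assms that[of "(b - a) / (c - a)"] by (auto simp: field_simps)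
  qed
  have eq: "subpath_of (subpath_of p a c) 0 u = subpath_of p a b"
    "subpath_of (subpath_of p a c) u 1 = subpath_of p b c"
    by (simp_all add: subpath_of_subpath_of u)
  show "(pconcat (subpath_of p a b) (subpath_of p b c), subpath_of p a c) \<in> dhrel T D Y"
    using dhrel_split[OF assms(1) u(1,2)] by (simp add: eq)
  show "subpath_of p a b \<in> dipaths D Y" "subpath_of p b c \<in> dipaths D Y"
    using dipaths_subpath_of'[OF assms(1), of 0 u] dipaths_subpath_of'[OF assms(1), of u 1] u
    by (simp_all add: eq)
qed

text \<open>Both concatenations run along the boundary from corner \<open>(0,0)\<close> to corner
  \<open>(1,1)\<close>, so \<open>dsquare_dhrel\<close> applies. The clipped ramps move one
  coordinate during the first half and the other during the second.\<close>

lemma dsquare_boundary: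
  assumes K: "dsquare T D Y K"
  shows "(pconcat (\<lambda>t. K (0, t)) (\<lambda>s. K (s, 1)), pconcat (\<lambda>s. K (s, 0)) (\<lambda>t. K (1, t))) \<in> dhrel T D Y"
proof (rule dsquare_dhrel[OF K])
  let ?u = "\<lambda>t::real. max 0 (2 * t - 1)" and ?v = "\<lambda>t::real. min 1 (2 * t)"
  have c: "continuous_on {0..1} ?u" "continuous_on {0..1} ?v" by (intro continuous_intros)+
  show "path2 (\<lambda>t. (?u t, ?v t))"
    by (rule path2I) (use c in \<open>auto intro!: continuous_on_Pair\<close>)
  show "path2 (\<lambda>t. (?v t, ?u t))"
    by (rule path2I) (use c in \<open>auto intro!: continuous_on_Pair\<close>)
  fix t :: real assume "0 \<le> t" "t \<le> 1"
  show "pconcat (\<lambda>t. K (0, t)) (\<lambda>s. K (s, 1)) t = K (?u t, ?v t)"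
    by (rule linorder_cases[of t "1/2"]; hypsubst?; simp add: pconcat_def)
  show "pconcat (\<lambda>s. K (s, 0)) (\<lambda>t. K (1, t)) t = K (?v t, ?u t)"
    by (rule linorder_cases[of t "1/2"]; hypsubst?; simp add: pconcat_def)
qed auto

lemma dsquare_sides:
  assumes K: "dsquare T D Y K" and "0 \<le> s" "s \<le> 1"
  shows "(\<lambda>t. K (s, t)) \<in> dipaths D Y" "(\<lambda>t. K (t, s)) \<in> dipaths D Y"
proof -
  have "path2 (\<lambda>t. (s, t))" "path2 (\<lambda>t. (t, s))"
    by (rule path2I; use assms in \<open>auto intro!: continuous_intros\<close>)+
  from this[THEN dsquare_path2[OF K]]
  show "(\<lambda>t. K (s, t)) \<in> dipaths D Y" "(\<lambda>t. K (t, s)) \<in> dipaths D Y"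
    by (simp_all add: comp_def)
qed

lemma Comp_darrow:
  assumes "p \<in> dipaths D Y" "q \<in> dipaths D Y" "p 1 = q 0"
  shows "Comp (fcat T D Y A) (darrow T D Y q) (darrow T D Y p) = darrow T D Y (pconcat p q)"
  using dhrel_pconcat[OF some_dclass[of p T D Y] some_dclass[of q T D Y] assms]
  by (simp add: fcat_def darrow_def dclass_eq_iff dhrel_sym)

lemma is_category_fcat:
  assumes "A \<subseteq> Y" "Y \<subseteq> topspace T"
  shows "is_category (fcat T D Y A)"
  unfolding is_category_def
proof (intro conjI ballI impI)
  fix a assume "a \<in> Obj (fcat T D Y A)"
  then show "Id (fcat T D Y A) a \<in> Arr (fcat T D Y A)"
    using assms dipaths_const by (auto intro!: darrow_in_Arr)
next
  fix f assume "f \<in> Arr (fcat T D Y A)"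
  then obtain p where p: "f = darrow T D Y p" "p \<in> dipaths D Y" "p 0 \<in> A" "p 1 \<in> A"
    by (rule Arr_fcatE)
  then have const: "(\<lambda>t. p 0) \<in> dipaths D Y" "(\<lambda>t. p 1) \<in> dipaths D Y"
    using dipaths_const assms by auto
  show "Comp (fcat T D Y A) (Id (fcat T D Y A) (Cod (fcat T D Y A) f)) f = f"
    "Comp (fcat T D Y A) f (Id (fcat T D Y A) (Dom (fcat T D Y A) f)) = f"
    using p const dhrel_pconcat_const[OF p(2)] by (simp_all add: Comp_darrow darrow_eqI)
next
  fix f g h assume fgh: "f \<in> Arr (fcat T D Y A)" "g \<in> Arr (fcat T D Y A)" "h \<in> Arr (fcat T D Y A)"
    and "Cod (fcat T D Y A) f = Dom (fcat T D Y A) g \<and> Cod (fcat T D Y A) g = Dom (fcat T D Y A) h"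
  moreover obtain p q r where pqr: "f = darrow T D Y p" "p \<in> dipaths D Y" "g = darrow T D Y q" "q \<in> dipaths D Y"
    "h = darrow T D Y r" "r \<in> dipaths D Y"
    using fgh by (metis Arr_fcatE)
  ultimately show "Comp (fcat T D Y A) h (Comp (fcat T D Y A) g f) =
      Comp (fcat T D Y A) (Comp (fcat T D Y A) h g) f"
    using dhrel_pconcat_assoc[of p Y q r] by (simp add: Comp_darrow dipaths_pconcat darrow_eqI)
qed (auto elim!: Arr_fcatE simp: Comp_darrow dipaths_pconcat intro!: darrow_in_Arr)

lemma is_functor_incl:
  assumes "A \<subseteq> A'" "Y \<subseteq> Z"
  shows "is_functor (incl T D Z) (fcat T D Y A) (fcat T D Z A')"
proof -
  have "dipaths D Y \<subseteq> dipaths D Z" using assms by (auto simp: dipaths_def)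
  then show ?thesis
    using assms unfolding is_functor_def
    by (auto elim!: Arr_fcatE simp: Comp_darrow dipaths_pconcat subset_iff intro!: darrow_in_Arr)
qed

end

section \<open>Chains of arrows and subdivisions\<close>

lemma
  assumes "is_category C"
  shows cat_Cod: "f \<in> Arr C \<Longrightarrow> Cod C f \<in> Obj C"
    and cat_Id: "a \<in> Obj C \<Longrightarrow> Id C a \<in> Arr C" "a \<in> Obj C \<Longrightarrow> Dom C (Id C a) = a"
      "a \<in> Obj C \<Longrightarrow> Cod C (Id C a) = a"
    and cat_Comp: "f \<in> Arr C \<Longrightarrow> g \<in> Arr C \<Longrightarrow> Cod C f = Dom C g \<Longrightarrow> Comp C g f \<in> Arr C"
      "f \<in> Arr C \<Longrightarrow> g \<in> Arr C \<Longrightarrow> Cod C f = Dom C g \<Longrightarrow> Dom C (Comp C g f) = Dom C f"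
      "f \<in> Arr C \<Longrightarrow> g \<in> Arr C \<Longrightarrow> Cod C f = Dom C g \<Longrightarrow> Cod C (Comp C g f) = Cod C g"
    and cat_left_Id: "f \<in> Arr C \<Longrightarrow> Cod C f = a \<Longrightarrow> Comp C (Id C a) f = f"
    and cat_right_Id: "f \<in> Arr C \<Longrightarrow> Dom C f = a \<Longrightarrow> Comp C f (Id C a) = f"
    and cat_assoc: "f \<in> Arr C \<Longrightarrow> g \<in> Arr C \<Longrightarrow> h \<in> Arr C \<Longrightarrow> Cod C f = Dom C g \<Longrightarrow>
      Cod C g = Dom C h \<Longrightarrow> Comp C h (Comp C g f) = Comp C (Comp C h g) f"
  using assms unfolding is_category_def by auto

lemma
  assumes "is_functor F C C'"
  shows functor_Obj: "a \<in> Obj C \<Longrightarrow> FObj F a \<in> Obj C'"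
    and functor_Arr: "f \<in> Arr C \<Longrightarrow> FArr F f \<in> Arr C'"
    and functor_Dom: "f \<in> Arr C \<Longrightarrow> Dom C' (FArr F f) = FObj F (Dom C f)"
    and functor_Cod: "f \<in> Arr C \<Longrightarrow> Cod C' (FArr F f) = FObj F (Cod C f)"
    and functor_Id: "a \<in> Obj C \<Longrightarrow> FArr F (Id C a) = Id C' (FObj F a)"
    and functor_Comp: "f \<in> Arr C \<Longrightarrow> g \<in> Arr C \<Longrightarrow> Cod C f = Dom C g \<Longrightarrow>
      FArr F (Comp C g f) = Comp C' (FArr F g) (FArr F f)"
  using assms unfolding is_functor_def by auto

primrec chain :: "('o, 'm) cat \<Rightarrow> 'o \<Rightarrow> (nat \<Rightarrow> 'm) \<Rightarrow> nat \<Rightarrow> 'm" where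
  "chain C x f 0 = Id C x"
| "chain C x f (Suc n) = Comp C (f n) (chain C x f n)"

text \<open>Requiring \<open>ob 0\<close> to be an object covers the empty chain, which is an
  identity; the later objects are codomains of arrows.\<close>

definition composable :: "('o, 'm) cat \<Rightarrow> (nat \<Rightarrow> 'o) \<Rightarrow> (nat \<Rightarrow> 'm) \<Rightarrow> nat \<Rightarrow> bool" where
  "composable C ob f n \<longleftrightarrow> ob 0 \<in> Obj C \<and>
     (\<forall>i<n. f i \<in> Arr C \<and> Dom C (f i) = ob i \<and> Cod C (f i) = ob (Suc i))"

lemma chain_cong: "(\<And>i. i < n \<Longrightarrow> f i = g i) \<Longrightarrow> chain C x f n = chain C x g n"
  by (induction n) auto

lemma chain_arr:
  assumes "is_category C" "composable C ob f n"
  shows "chain C (ob 0) f n \<in> Arr C \<and> Dom C (chain C (ob 0) f n) = ob 0 \<and> Cod C (chain C (ob 0) f n) = ob n"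
  using assms(2)
  by (induction n) (auto simp: composable_def cat_Id[OF assms(1)] cat_Comp[OF assms(1)])

lemma composable_shift:
  assumes C: "is_category C" and f: "composable C ob f (m + n)"
  shows "composable C (\<lambda>i. ob (m + i)) (\<lambda>i. f (m + i)) n" "composable C ob f m"
proof -
  show "composable C ob f m" using f by (auto simp: composable_def)
  have "ob m \<in> Obj C"
  proof (cases m)
    case 0
    then show ?thesis using f by (simp add: composable_def)
  next
    case (Suc k)
    then have "f k \<in> Arr C" "Cod C (f k) = ob m" using f by (auto simp: composable_def)
    then show ?thesis using cat_Cod[OF C] by metis
  qed
  then show "composable C (\<lambda>i. ob (m + i)) (\<lambda>i. f (m + i)) n"
    using f by (auto simp: composable_def)
qed

lemma chain_add:
  assumes C: "is_category C" and f: "composable C ob f (m + n)"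
  shows "chain C (ob 0) f (m + n) = Comp C (chain C (ob m) (\<lambda>i. f (m + i)) n) (chain C (ob 0) f m)"
  using f
proof (induction n)
  case 0
  then show ?case using chain_arr[OF C, of ob f m] by (simp add: cat_left_Id[OF C])
next
  case (Suc n)
  then have c: "composable C ob f (m + n)" by (auto simp: composable_def)
  note a = chain_arr[OF C composable_shift(1)[OF C c]] chain_arr[OF C composable_shift(2)[OF C c]]
  have "f (m + n) \<in> Arr C" "Dom C (f (m + n)) = ob (m + n)" using Suc.prems by (auto simp: composable_def)
  then show ?case using Suc.IH[OF c] a by (simp add: cat_assoc[OF C])
qed

text \<open>The bracketing of a refinement: each of \<open>N\<close> coarse pieces contributes a
  block of \<open>M\<close> consecutive fine arrows.\<close>

lemma chain_mult:
  assumes C: "is_category C" and f: "composable C ob f (N * M)"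
  shows "chain C (ob 0) f (N * M) = chain C (ob 0) (\<lambda>i. chain C (ob (i * M)) (\<lambda>j. f (i * M + j)) M) N"
  using f
proof (induction N)
  case (Suc N)
  have c: "composable C ob f (N * M + M)" using Suc.prems by (simp add: add.commute)
  show ?case using chain_add[OF C c] Suc.IH[OF composable_shift(2)[OF C c]] by (simp add: add.commute)
qed simp

context d_space
begin

lemma dsquare_restrict:
  assumes "dsquare T D Z K" "\<And>s t. 0 \<le> s \<Longrightarrow> s \<le> 1 \<Longrightarrow> 0 \<le> t \<Longrightarrow> t \<le> 1 \<Longrightarrow> K (s, t) \<in> Y"
  shows "dsquare T D Y K"
  using assms unfolding dsquare_def by (auto simp: continuous_map_in_subtopology)

lemma dsquare_cell:
  assumes H: "dsquare T D Z H" and ab: "0 \<le> a" "a \<le> b" "b \<le> 1" and cd: "0 \<le> c" "c \<le> d" "d \<le> 1"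
    and Y: "\<And>s t. a \<le> s \<Longrightarrow> s \<le> b \<Longrightarrow> c \<le> t \<Longrightarrow> t \<le> d \<Longrightarrow> H (s, t) \<in> Y"
  shows "dsquare T D Y (\<lambda>z. H (a + fst z * (b - a), c + snd z * (d - c)))"
proof (rule dsquare_restrict)
  note bd = affine_unit_bounds[OF ab(2)] affine_unit_bounds[OF cd(2)]
  have "dsquare T D Z (H \<circ> (\<lambda>z. (a + fst z * (b - a), c + snd z * (d - c))))"
  proof (rule dsquare_comp[OF H])
    show "continuous_on ({0..1} \<times> {0..1}) (\<lambda>z. (a + fst z * (b - a), c + snd z * (d - c)))"
      by (intro continuous_intros)
    show "(\<lambda>z. (a + fst z * (b - a), c + snd z * (d - c))) ` ({0..1} \<times> {0..1}) \<subseteq> {0..1} \<times> {0..1}"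
      using order_trans[OF ab(1) bd(1)] order_trans[OF bd(2) ab(3)]
        order_trans[OF cd(1) bd(3)] order_trans[OF bd(4) cd(3)] by auto
  qed (use ab cd in \<open>auto intro!: mult_right_mono\<close>)
  then show "dsquare T D Z (\<lambda>z. H (a + fst z * (b - a), c + snd z * (d - c)))" by (simp add: comp_def)
qed (use affine_unit_bounds[OF ab(2)] affine_unit_bounds[OF cd(2)] Y in simp)

text \<open>Paths are total functions on the reals, and pieces of a path often agree only on the
  unit interval. Homotopies see nothing else, so such paths have the same class.\<close>

lemma dhrel_cong:
  assumes "p \<in> dipaths D Y" "\<And>t. 0 \<le> t \<Longrightarrow> t \<le> 1 \<Longrightarrow> q t = p t"
  shows "(p, q) \<in> dhrel T D Y"
  by (rule dhrel_reparam[OF assms(1), of "\<lambda>t. t" "\<lambda>t. t"]) (use assms(2) in \<open>auto simp: mono_on_def\<close>)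

end

section \<open>Subdivisions subordinate to the cover\<close>

locale d_cover = d_space +
  fixes X1 X2 :: "'a set"
  assumes X1: "X1 \<subseteq> topspace T" and X2: "X2 \<subseteq> topspace T"
    and cover: "topspace T = T interior_of X1 \<union> T interior_of X2"
begin

abbreviation "X \<equiv> topspace T"

lemma topspace_covered: "X \<subseteq> X1 \<union> X2"
  using cover interior_of_subset[of T X1] interior_of_subset[of T X2] by auto

definition small :: "(real \<Rightarrow> 'a) \<Rightarrow> bool" where
  "small p \<longleftrightarrow> (\<exists>Y\<in>{X1, X2}. p \<in> dipaths D Y)"

definition small_pieces :: "(real \<Rightarrow> 'a) \<Rightarrow> nat \<Rightarrow> bool" where
  "small_pieces p N \<longleftrightarrow> N > 0 \<and> (\<forall>i<N. small (subpath_of p (real i / real N) (real (Suc i) / real N)))"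

text \<open>A Lebesgue number argument for the preimages of the two interiors. It is stated for
  squares so that one lemma serves homotopies and, through squares constant in one coordinate,
  paths.\<close>

lemma grid_exists:
  assumes H: "continuous_map (top_of_set ({0..1} \<times> {0..1})) T (H :: real \<times> real \<Rightarrow> 'a)"
  obtains N :: nat where "N > 0"
    "\<And>i j. i < N \<Longrightarrow> j < N \<Longrightarrow> \<exists>Y\<in>{X1, X2}. \<forall>s t. real i / real N \<le> s \<longrightarrow> s \<le> real (Suc i) / real N \<longrightarrow>
       real j / real N \<le> t \<longrightarrow> t \<le> real (Suc j) / real N \<longrightarrow> H (s, t) \<in> Y"
proof -
  let ?S = "{0..1} \<times> {0..1} :: (real \<times> real) set"
  \<comment> \<open>The Lebesgue number lemma is applied with open sets of the plane, so the
    relatively open preimages are extended beyond the square.\<close>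
  have "\<exists>U. open U \<and> {z \<in> ?S. H z \<in> T interior_of Y} = ?S \<inter> U" for Y
    using openin_continuous_map_preimage[OF H, of "T interior_of Y"] by (auto simp: openin_open)
  then obtain U where U: "\<And>Y. open (U Y)" "\<And>Y. {z \<in> ?S. H z \<in> T interior_of Y} = ?S \<inter> U Y"
    by metis
  have "H z \<in> X" if "z \<in> ?S" for z using H that by (auto simp: continuous_map_def Pi_iff)
  then have "z \<in> U X1 \<or> z \<in> U X2" if "z \<in> ?S" for z
    using that cover U(2)[of X1] U(2)[of X2] by (metis (mono_tags, lifting) IntD2 UnE mem_Collect_eq)
  then have sub: "?S \<subseteq> \<Union>{U X1, U X2}" by (intro subsetI) simp
  have "compact ?S" by (intro compact_Times compact_Icc)
  then obtain \<delta> where \<delta>: "\<delta> > 0"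
    "\<And>A. A \<subseteq> ?S \<Longrightarrow> diameter A < \<delta> \<Longrightarrow> \<exists>B\<in>{U X1, U X2}. A \<subseteq> B"
    by (rule Lebesgue_number_lemma[of ?S "{U X1, U X2}"]) (use sub U(1) in auto)
  \<comment> \<open>A cell of side \<open>1/N\<close> has diameter at most \<open>2/N\<close>, the
    sum of its two side lengths.\<close>
  obtain N :: nat where N: "N > 0" "2 / real N < \<delta>"
    using reals_Archimedean2[of "2 / \<delta>"] \<delta>(1)
    by (metis divide_pos_pos gr0I mult.commute not_less_iff_gr_or_eq of_nat_0 of_nat_0_less_iff order_less_trans pos_divide_less_eq zero_less_numeral)
  show ?thesis
  proof (rule that[OF N(1)])
    fix i j assume ij: "i < N" "j < N"
    let ?A = "{real i / N..real (Suc i) / N} \<times> {real j / N..real (Suc j) / N}"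
    have i: "real (Suc i) / N \<le> 1" "real (Suc j) / N \<le> 1" using ij N by auto
    have AS: "?A \<subseteq> ?S" using i by auto (smt (verit) divide_nonneg_nonneg of_nat_0_le_iff)+
    have "diameter ?A \<le> 2 / N"
    proof (rule diameter_le)
      fix x y assume xy: "x \<in> ?A" "y \<in> ?A"
      have *: "\<bar>u - v\<bar> \<le> 1 / N" if "u \<in> {real k / N..real (Suc k) / N}" "v \<in> {real k / N..real (Suc k) / N}"
        for u v k
      proof -
        have "real (Suc k) / N = real k / N + 1 / N" by (simp add: add_divide_distrib)
        then show ?thesis using that unfolding atLeastAtMost_iff by linarith
      qed
      have "\<bar>fst x - fst y\<bar> \<le> 1 / N" "\<bar>snd x - snd y\<bar> \<le> 1 / N"
        using xy unfolding mem_Times_iff by (blast intro: *)+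
      moreover have "norm (x - y) \<le> \<bar>fst x - fst y\<bar> + \<bar>snd x - snd y\<bar>"
        using norm_Pair_le[of "fst x - fst y" "snd x - snd y"]
        by (simp add: fst_diff[symmetric] snd_diff[symmetric] del: fst_diff snd_diff)
      ultimately show "norm (x - y) \<le> 2 / N" by simp
    qed simp
    then have "\<exists>B\<in>{U X1, U X2}. ?A \<subseteq> B" using N(2) by (intro \<delta>(2)[OF AS]) simp
    then obtain Y where Y: "Y \<in> {X1, X2}" "?A \<subseteq> U Y" by blast
    have "H z \<in> Y" if "z \<in> ?A" for z
    proof -
      have "z \<in> ?S \<inter> U Y" using that AS Y(2) by (intro IntI) (rule subsetD; assumption)+
      then have "H z \<in> T interior_of Y" unfolding U(2)[symmetric] by simp
      then show ?thesis by (rule subsetD[OF interior_of_subset])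
    qed
    then show "\<exists>Y\<in>{X1, X2}. \<forall>s t. real i / real N \<le> s \<longrightarrow> s \<le> real (Suc i) / real N \<longrightarrow>
       real j / real N \<le> t \<longrightarrow> t \<le> real (Suc j) / real N \<longrightarrow> H (s, t) \<in> Y"
      using Y(1) by (intro bexI[of _ Y]) auto
  qed
qed

lemma unit_fractions:
  assumes "i < N"
  shows "0 \<le> real i / real N" "real i / real N \<le> real (Suc i) / real N" "real (Suc i) / real N \<le> 1"
  using assms by (auto simp: divide_right_mono)

lemma small_pieces_exist:
  assumes "p \<in> D"
  obtains N where "small_pieces p N"
proof -
  have "dsquare T D X (\<lambda>z. p (snd z))"
    using dsquare_of_dipath[of p X] assms by (simp add: dipaths_topspace)
  then have "continuous_map (top_of_set ({0..1} \<times> {0..1})) T (\<lambda>z::real \<times> real. p (snd z))"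
    by (simp add: dsquare_def)
  then obtain N :: nat where N: "N > 0"
    "\<And>i j. i < N \<Longrightarrow> j < N \<Longrightarrow> \<exists>Y\<in>{X1, X2}. \<forall>s t. real i / real N \<le> s \<longrightarrow> s \<le> real (Suc i) / real N \<longrightarrow>
       real j / real N \<le> t \<longrightarrow> t \<le> real (Suc j) / real N \<longrightarrow> p (snd (s, t)) \<in> Y"
    by (rule grid_exists) blast
  have "small (subpath_of p (real i / real N) (real (Suc i) / real N))" if i: "i < N" for i
  proof -
    note u = unit_fractions[OF i]
    \<comment> \<open>The square does not depend on its first coordinate, so any row of cells will
      do; \<open>i\<close> serves as row index because it is already known to be below
      \<open>N\<close>.\<close>
    obtain Y where Y: "Y \<in> {X1, X2}"
      "\<And>t. real i / real N \<le> t \<Longrightarrow> t \<le> real (Suc i) / real N \<Longrightarrow> p t \<in> Y"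
      using N(2)[OF i i] u(2) by (metis order_refl snd_conv)
    then show ?thesis
      unfolding small_def by (intro bexI[of _ Y] dipaths_subpath_of[OF assms u])
  qed
  then show ?thesis using N(1) that[of N] by (simp add: small_pieces_def)
qed

lemma small_const: "x \<in> X \<Longrightarrow> small (\<lambda>t. x)"
  using topspace_covered X1 X2 dipaths_const by (auto simp: small_def)

lemma small_D: "small p \<Longrightarrow> p \<in> D"
  by (auto simp: small_def dipaths_def)

lemma small_cong: "small p \<Longrightarrow> (\<And>t. 0 \<le> t \<Longrightarrow> t \<le> 1 \<Longrightarrow> q t = p t) \<Longrightarrow> small q"
  unfolding small_def using dipaths_cong by blast

text \<open>Classes of small dipaths generate the category on all points: the induction runs over
  the prefixes of a subdivision and starts from a constant path, which is small. It serves both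
  naturality of the glued unit and uniqueness.\<close>

lemma darrow_induct [consumes 1, case_names small Comp]:
  assumes "f \<in> Arr (fcat T D X X)"
    and small: "\<And>p. small p \<Longrightarrow> P (darrow T D X p)"
    and Comp: "\<And>f g. f \<in> Arr (fcat T D X X) \<Longrightarrow> g \<in> Arr (fcat T D X X) \<Longrightarrow> P f \<Longrightarrow> P g \<Longrightarrow>
      fst (snd f) = fst g \<Longrightarrow> P (Comp (fcat T D X X) g f)"
  shows "P f"
proof -
  obtain p where p: "f = darrow T D X p" "p \<in> D"
    using assms(1) by (elim Arr_fcatE) (auto simp: dipaths_topspace)
  obtain N where N: "small_pieces p N" using small_pieces_exist[OF p(2)] by blast
  have "n \<le> N \<Longrightarrow> P (darrow T D X (subpath_of p 0 (real n / real N)))" for n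
  proof (induction n)
    case 0
    have "small (\<lambda>t. p 0)" using small_const D_subset_topspace[OF p(2)] by simp
    then show ?case using small by (simp add: subpath_of_def)
  next
    case (Suc n)
    then have n: "n < N" by simp
    note u = unit_fractions[OF n]
    let ?a = "subpath_of p 0 (real n / real N)"
      and ?b = "subpath_of p (real n / real N) (real (Suc n) / real N)"
      and ?c = "subpath_of p 0 (real (Suc n) / real N)"
    have c: "?c \<in> dipaths D X" using p u by (auto simp: dipaths_topspace intro!: D_subpath_of)
    note s = dhrel_split_subpath_of[OF c u(1,2)]
    have ab: "?a 1 = ?b 0" by (simp add: subpath_of_def)
    have "P (Comp (fcat T D X X) (darrow T D X ?b) (darrow T D X ?a))"
    proof (rule Comp)
      show "P (darrow T D X ?b)" using small N n by (simp add: small_pieces_def)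
      show "P (darrow T D X ?a)" using Suc by simp
      show "fst (snd (darrow T D X ?a)) = fst (darrow T D X ?b)" using ab by simp
    qed (use s dipaths_ends in \<open>blast intro!: darrow_in_Arr\<close>)+
    also have "Comp (fcat T D X X) (darrow T D X ?b) (darrow T D X ?a) = darrow T D X ?c"
      using Comp_darrow[OF s(2,3) ab] darrow_eqI[OF s(1)] by simp
    finally show ?case .
  qed
  from this[of N] show ?thesis using N p by (simp add: small_pieces_def subpath_of_def)
qed

end

section \<open>Van Kampen for the full fundamental category\<close>

locale d_cocone = d_cover T D X1 X2
  for T :: "'a topology" and D :: "(real \<Rightarrow> 'a) set" and X1 X2 :: "'a set" +
  fixes C :: "('o, 'm) cat" and F1 F2 :: "('a, 'a darr, 'o, 'm) ftor"
  assumes C: "is_category C"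
    and F1: "is_functor F1 (fcat T D X1 X1) C" and F2: "is_functor F2 (fcat T D X2 X2) C"
    and F12: "feq (fcat T D (X1 \<inter> X2) (X1 \<inter> X2)) (fcomp F1 (incl T D X1)) (fcomp F2 (incl T D X2))"
begin

definition ob :: "'a \<Rightarrow> 'o" where
  "ob x = (if x \<in> X1 then FObj F1 x else FObj F2 x)"

definition small_val :: "(real \<Rightarrow> 'a) \<Rightarrow> 'm" where
  "small_val p = (if p \<in> dipaths D X1 then FArr F1 (darrow T D X1 p) else FArr F2 (darrow T D X2 p))"

lemma ob_eq: "x \<in> X1 \<Longrightarrow> ob x = FObj F1 x" "x \<in> X2 \<Longrightarrow> ob x = FObj F2 x"
  using F12 by (auto simp: ob_def feq_def fcomp_def)

text \<open>The definition prefers \<open>F1\<close>, and on the overlap this choice is harmless: a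
  dipath in both pieces is a dipath in \<open>X1 \<inter> X2\<close>, so its class comes from the
  category where the cocone condition holds.\<close>

lemma small_val_eq:
  "p \<in> dipaths D X1 \<Longrightarrow> small_val p = FArr F1 (darrow T D X1 p)"
  "p \<in> dipaths D X2 \<Longrightarrow> small_val p = FArr F2 (darrow T D X2 p)"
proof -
  assume p2: "p \<in> dipaths D X2"
  show "small_val p = FArr F2 (darrow T D X2 p)"
  proof (cases "p \<in> dipaths D X1")
    case True
    with p2 have p: "p \<in> dipaths D (X1 \<inter> X2)" by (auto simp: dipaths_def)
    then have "darrow T D (X1 \<inter> X2) p \<in> Arr (fcat T D (X1 \<inter> X2) (X1 \<inter> X2))"
      using dipaths_ends by (intro darrow_in_Arr) auto
    then have "FArr (fcomp F1 (incl T D X1)) (darrow T D (X1 \<inter> X2) p) =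
        FArr (fcomp F2 (incl T D X2)) (darrow T D (X1 \<inter> X2) p)"
      using F12 by (simp add: feq_def)
    then show ?thesis using True by (simp add: fcomp_def small_val_def)
  qed (simp add: small_val_def)
qed (simp add: small_val_def)

text \<open>Hides which of the two pieces is meant, so that the following facts about small dipaths
  are proved once.\<close>

lemma piece_cases:
  assumes "Y \<in> {X1, X2}"
  obtains F where "is_functor F (fcat T D Y Y) C" "\<And>x. x \<in> Y \<Longrightarrow> ob x = FObj F x"
    "\<And>p. p \<in> dipaths D Y \<Longrightarrow> small_val p = FArr F (darrow T D Y p)"
  using assms F1 F2 ob_eq small_val_eq by blast

lemma ob_in_Obj: "x \<in> X \<Longrightarrow> ob x \<in> Obj C"
proof -
  assume "x \<in> X"
  then obtain Y where Y: "Y \<in> {X1, X2}" "x \<in> Y" using topspace_covered by auto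
  obtain F where "is_functor F (fcat T D Y Y) C" "ob x = FObj F x"
    using piece_cases[OF Y(1)] Y(2) by metis
  then show ?thesis using functor_Obj[of F "fcat T D Y Y" C x] Y(2) by simp
qed

lemma small_val_arr:
  assumes "small p"
  shows "small_val p \<in> Arr C" "Dom C (small_val p) = ob (p 0)" "Cod C (small_val p) = ob (p 1)"
proof -
  obtain Y where Y: "Y \<in> {X1, X2}" "p \<in> dipaths D Y" using assms by (auto simp: small_def)
  obtain F where F: "is_functor F (fcat T D Y Y) C" "\<And>x. x \<in> Y \<Longrightarrow> ob x = FObj F x"
    "small_val p = FArr F (darrow T D Y p)"
    using piece_cases[OF Y(1)] Y(2) by metis
  have a: "darrow T D Y p \<in> Arr (fcat T D Y Y)" using dipaths_ends[OF Y(2)] Y(2) by (intro darrow_in_Arr) auto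
  show "small_val p \<in> Arr C" "Dom C (small_val p) = ob (p 0)" "Cod C (small_val p) = ob (p 1)"
    using functor_Arr[OF F(1) a] functor_Dom[OF F(1) a] functor_Cod[OF F(1) a] F(2,3) dipaths_ends[OF Y(2)]
    by simp_all
qed

lemma small_val_pconcat:
  assumes Y: "Y \<in> {X1, X2}" and p: "p \<in> dipaths D Y" and q: "q \<in> dipaths D Y" and pq: "p 1 = q 0"
  shows "small_val (pconcat p q) = Comp C (small_val q) (small_val p)"
proof -
  obtain F where F: "is_functor F (fcat T D Y Y) C"
    "\<And>p. p \<in> dipaths D Y \<Longrightarrow> small_val p = FArr F (darrow T D Y p)"
    using piece_cases[OF Y] by metis
  have a: "darrow T D Y p \<in> Arr (fcat T D Y Y)" "darrow T D Y q \<in> Arr (fcat T D Y Y)"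
    using dipaths_ends[OF p] dipaths_ends[OF q] p q by (auto intro!: darrow_in_Arr)
  show ?thesis
    using functor_Comp[OF F(1) a] pq F(2) p q dipaths_pconcat[OF p q pq] Comp_darrow[OF p q pq, of Y]
    by simp
qed

lemma small_val_dhrel:
  assumes Y: "Y \<in> {X1, X2}" and p: "p \<in> dipaths D Y" and pq: "(p, q) \<in> dhrel T D Y"
  shows "small_val p = small_val q"
proof -
  obtain F :: "('a, 'a darr, 'o, 'm) ftor" where "\<And>p. p \<in> dipaths D Y \<Longrightarrow> small_val p = FArr F (darrow T D Y p)"
    using piece_cases[OF Y] by metis
  then show ?thesis using p dhrel_ends(1)[OF pq] darrow_eqI[OF pq] by simp
qed

lemma small_val_cong:
  assumes "small p" "\<And>t. 0 \<le> t \<Longrightarrow> t \<le> 1 \<Longrightarrow> q t = p t"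
  shows "small_val q = small_val p"
  using assms dhrel_cong[of p _ q] small_val_dhrel unfolding small_def by metis

lemma small_val_const:
  assumes "x \<in> X"
  shows "small_val (\<lambda>t. x) = Id C (ob x)"
proof -
  obtain Y where Y: "Y \<in> {X1, X2}" "x \<in> Y" using assms topspace_covered by auto
  obtain F where F: "is_functor F (fcat T D Y Y) C" "ob x = FObj F x"
    "\<And>p. p \<in> dipaths D Y \<Longrightarrow> small_val p = FArr F (darrow T D Y p)"
    using piece_cases[OF Y(1)] Y(2) by metis
  have "(\<lambda>t. x) \<in> dipaths D Y" using Y X1 X2 by (auto intro: dipaths_const)
  then show ?thesis using F functor_Id[OF F(1), of x] Y(2) by simp
qed

lemma small_val_split:
  assumes "small (subpath_of p a c)" "a \<le> b" "b \<le> c"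
  shows "small_val (subpath_of p a c) = Comp C (small_val (subpath_of p b c)) (small_val (subpath_of p a b))"
    and "small (subpath_of p a b)" "small (subpath_of p b c)"
proof -
  obtain Y where Y: "Y \<in> {X1, X2}" "subpath_of p a c \<in> dipaths D Y" using assms by (auto simp: small_def)
  note s = dhrel_split_subpath_of[OF Y(2) assms(2,3)]
  show "small (subpath_of p a b)" "small (subpath_of p b c)" using s(2,3) Y(1) by (auto simp: small_def)
  have e: "subpath_of p a b 1 = subpath_of p b c 0" by (simp add: subpath_of_def)
  show "small_val (subpath_of p a c) = Comp C (small_val (subpath_of p b c)) (small_val (subpath_of p a b))"
    using small_val_pconcat[OF Y(1) s(2,3) e] small_val_dhrel[OF Y(1) Y(2) dhrel_sym[OF s(1)]] by simp
qed

text \<open>Within one piece this is functoriality, applied by splitting off the last part.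
  Smallness of all parts is recorded because a refined subdivision must again consist of small
  pieces.\<close>

lemma small_val_chain:
  assumes "small (subpath_of p (t 0) (t n))" "\<And>i. i < n \<Longrightarrow> t i \<le> t (Suc i)"
  shows "chain C (ob (p (t 0))) (\<lambda>i. small_val (subpath_of p (t i) (t (Suc i)))) n =
         small_val (subpath_of p (t 0) (t n)) \<and> (\<forall>i<n. small (subpath_of p (t i) (t (Suc i))))"
  using assms
proof (induction n)
  case 0
  have "subpath_of p (t 0) (t 0) = (\<lambda>_. p (t 0))" by (simp add: subpath_of_def)
  moreover have "p (t 0) \<in> X" using D_subset_topspace[OF small_D[OF 0(1)], of 0] by (simp add: subpath_of_def)
  ultimately show ?case by (simp add: small_val_const)
next
  case (Suc n)
  have "k \<le> n \<Longrightarrow> t 0 \<le> t k" for k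
  proof (induction k)
    case (Suc k)
    then show ?case using Suc.prems \<open>\<And>i. i < Suc n \<Longrightarrow> t i \<le> t (Suc i)\<close>[of k] by simp
  qed simp
  from this[of n] have "t 0 \<le> t n" by simp
  note s = small_val_split[OF Suc.prems(1) this Suc.prems(2)[of n, OF lessI]]
  then have "chain C (ob (p (t 0))) (\<lambda>i. small_val (subpath_of p (t i) (t (Suc i)))) n =
      small_val (subpath_of p (t 0) (t n))" "\<forall>i<n. small (subpath_of p (t i) (t (Suc i)))"
    using Suc.IH Suc.prems(2) by simp_all
  then show ?case using s by (simp add: less_Suc_eq)
qed

section \<open>The value of an arbitrary dipath under a cocone\<close>

definition subdiv_val :: "(real \<Rightarrow> 'a) \<Rightarrow> nat \<Rightarrow> 'm" where
  "subdiv_val p N = chain C (ob (p 0)) (\<lambda>i. small_val (subpath_of p (real i / real N) (real (Suc i) / real N))) N"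

lemma small_pieces_D:
  assumes "small_pieces p N"
  shows "\<And>i. i \<le> N \<Longrightarrow> p (real i / real N) \<in> X"
proof -
  fix i assume "i \<le> N"
  then consider "i < N" | j where "i = Suc j" "j < N" using assms by (cases i) (auto simp: small_pieces_def)
  then show "p (real i / real N) \<in> X"
  proof cases
    case 1
    then have "subpath_of p (real i / real N) (real (Suc i) / real N) \<in> D"
      using assms small_D unfolding small_pieces_def by blast
    from D_subset_topspace[OF this, of 0] show ?thesis by (simp add: subpath_of_def)
  next
    case 2
    then have "subpath_of p (real j / real N) (real i / real N) \<in> D"
      using assms small_D unfolding small_pieces_def by blast
    from D_subset_topspace[OF this, of 1] show ?thesis by (simp add: subpath_of_def)
  qed
qed

lemma composable_small_pieces:
  assumes N: "small_pieces p N"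
  shows "composable C (\<lambda>i. ob (p (real i / real N)))
    (\<lambda>i. small_val (subpath_of p (real i / real N) (real (Suc i) / real N))) N"
  unfolding composable_def
proof (intro conjI allI impI)
  show "ob (p (real 0 / real N)) \<in> Obj C" using small_pieces_D[OF N, of 0] ob_in_Obj by simp
  fix i assume "i < N"
  then have s: "small (subpath_of p (real i / real N) (real (Suc i) / real N))"
    using N unfolding small_pieces_def by blast
  show "small_val (subpath_of p (real i / real N) (real (Suc i) / real N)) \<in> Arr C"
    "Dom C (small_val (subpath_of p (real i / real N) (real (Suc i) / real N))) = ob (p (real i / real N))"
    "Cod C (small_val (subpath_of p (real i / real N) (real (Suc i) / real N))) = ob (p (real (Suc i) / real N))"
    using small_val_arr[OF s] by (simp_all add: subpath_of_def)
qed

lemma subdiv_val_arr: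
  assumes "small_pieces p N"
  shows "subdiv_val p N \<in> Arr C" "Dom C (subdiv_val p N) = ob (p 0)" "Cod C (subdiv_val p N) = ob (p 1)"
proof -
  have "N > 0" using assms by (simp add: small_pieces_def)
  then show "subdiv_val p N \<in> Arr C" "Dom C (subdiv_val p N) = ob (p 0)" "Cod C (subdiv_val p N) = ob (p 1)"
    using chain_arr[OF C composable_small_pieces[OF assms]] by (simp_all add: subdiv_val_def)
qed

text \<open>A coarse piece is small, so \<open>small_val_chain\<close> collapses its
  \<open>M\<close> fine pieces to its own value; \<open>chain_mult\<close> does this in every block
  at once.\<close>

lemma subdiv_val_refine:
  assumes N: "small_pieces p N" and M: "M > 0"
  shows "small_pieces p (N * M)" "subdiv_val p (N * M) = subdiv_val p N"
proof -
  let ?t = "\<lambda>k. real k / real (N * M)"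
  have N0: "N > 0" using N by (simp add: small_pieces_def)
  have ends: "?t (i * M) = real i / real N" for i using M by simp
  have block: "chain C (ob (p (?t (i * M)))) (\<lambda>j. small_val (subpath_of p (?t (i * M + j)) (?t (Suc (i * M + j))))) M =
      small_val (subpath_of p (real i / real N) (real (Suc i) / real N)) \<and>
      (\<forall>j<M. small (subpath_of p (?t (i * M + j)) (?t (Suc (i * M + j)))))" if i: "i < N" for i
  proof -
    have e: "?t (i * M + M) = real (Suc i) / real N" using ends[of "Suc i"] by (simp add: add.commute)
    have "small (subpath_of p (?t (i * M + 0)) (?t (i * M + M)))"
      unfolding e add_0_right ends using N i unfolding small_pieces_def by blast
    from small_val_chain[of p "\<lambda>j. ?t (i * M + j)", OF this]
    show ?thesis unfolding e add_0_right ends add_Suc_right[symmetric]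
      by (simp add: divide_right_mono del: of_nat_add of_nat_mult of_nat_Suc)
  qed
  show NM: "small_pieces p (N * M)"
    unfolding small_pieces_def
  proof (intro conjI allI impI)
    fix k assume k: "k < N * M"
    \<comment> \<open>Fine piece \<open>k\<close> sits in block \<open>k div M\<close> at position
      \<open>k mod M\<close>.\<close>
    then have "k div M < N" by (simp add: less_mult_imp_div_less)
    moreover have "k = (k div M) * M + k mod M" "k mod M < M" using M by simp_all
    ultimately show "small (subpath_of p (?t k) (?t (Suc k)))" using block by metis
  qed (use N0 M in simp)
  have "subdiv_val p (N * M) =
      chain C (ob (p (?t 0))) (\<lambda>i. chain C (ob (p (?t (i * M))))
        (\<lambda>j. small_val (subpath_of p (?t (i * M + j)) (?t (Suc (i * M + j))))) M) N"
    using chain_mult[OF C composable_small_pieces[OF NM]] by (simp add: subdiv_val_def)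
  also have "\<dots> = chain C (ob (p 0)) (\<lambda>i. small_val (subpath_of p (real i / real N) (real (Suc i) / real N))) N"
  proof -
    have "?t 0 = 0" by simp
    then show ?thesis using block by (simp only:) (intro chain_cong, blast)
  qed
  finally show "subdiv_val p (N * M) = subdiv_val p N" by (simp add: subdiv_val_def)
qed

lemma subdiv_val_unique:
  assumes "small_pieces p N" "small_pieces p M"
  shows "subdiv_val p N = subdiv_val p M"
  using subdiv_val_refine(2)[OF assms(1), of M] subdiv_val_refine(2)[OF assms(2), of N] assms
  by (simp add: mult.commute small_pieces_def)

definition val :: "(real \<Rightarrow> 'a) \<Rightarrow> 'm" where
  "val p = subdiv_val p (SOME N. small_pieces p N)"

lemma val_eq: "small_pieces p N \<Longrightarrow> val p = subdiv_val p N"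
  unfolding val_def by (rule subdiv_val_unique[OF someI])

lemma val_small: "small p \<Longrightarrow> val p = small_val p"
proof -
  assume p: "small p"
  then have "small_pieces p 1" by (simp add: small_pieces_def)
  then have "val p = Comp C (small_val p) (Id C (ob (p 0)))" using val_eq by (simp add: subdiv_val_def)
  then show ?thesis using small_val_arr[OF p] cat_right_Id[OF C] by simp
qed

lemma val_arr:
  assumes "p \<in> D"
  shows "val p \<in> Arr C" "Dom C (val p) = ob (p 0)" "Cod C (val p) = ob (p 1)"
  using small_pieces_exist[OF assms] val_eq subdiv_val_arr by metis+

text \<open>Concatenation gives each factor half of the interval. Equal pieces of the whole
  therefore restrict to equal pieces of both factors only if these use the same number of pieces, so
  both are first refined to \<open>K = N * M\<close>, and the whole is cut into
  \<open>K + K\<close>.\<close>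

lemma val_pconcat:
  assumes p: "p \<in> D" and q: "q \<in> D" and pq: "p 1 = q 0"
  shows "val (pconcat p q) = Comp C (val q) (val p)"
proof -
  obtain N M where NM: "small_pieces p N" "small_pieces q M" using small_pieces_exist p q by metis
  then have pos: "N > 0" "M > 0" by (simp_all add: small_pieces_def)
  define K where "K = N * M"
  have K: "small_pieces p K" "small_pieces q K"
    using subdiv_val_refine(1)[OF NM(1) pos(2)] subdiv_val_refine(1)[OF NM(2) pos(1)]
    by (simp_all only: K_def mult.commute)
  then have K0: "K > 0" by (simp add: small_pieces_def)
  let ?r = "pconcat p q"
  let ?s = "\<lambda>i. subpath_of ?r (real i / real (K + K)) (real (Suc i) / real (K + K))"
  let ?p = "\<lambda>i. subpath_of p (real i / real K) (real (Suc i) / real K)"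
  let ?q = "\<lambda>i. subpath_of q (real i / real K) (real (Suc i) / real K)"
  \<comment> \<open>The pieces are compared on the unit interval only: outside it the last piece of
    the first half runs across the join and need not follow \<open>p\<close>.\<close>
  have sp: "?s i t = ?p i t" if "i < K" "0 \<le> t" "t \<le> 1" for i t
  proof -
    have e: "real i / real (K + K) + t * (real (Suc i) / real (K + K) - real i / real (K + K)) =
      (real i / real K + t * (real (Suc i) / real K - real i / real K)) / 2"
      using K0 by (simp add: field_simps)
    have "real i / real K + t * (real (Suc i) / real K - real i / real K) \<le> 1"
      using affine_unit_bounds(2)[OF unit_fractions(2)[OF that(1)] that(2,3)] unit_fractions(3)[OF that(1)]
      by linarith
    then show ?thesis unfolding subpath_of_def e by (rule pconcat_first_half)
  qed
  have sq: "?s (K + i) t = ?q i t" if "i < K" "0 \<le> t" "t \<le> 1" for i t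
  proof -
    have e: "real (K + i) / real (K + K) + t * (real (Suc (K + i)) / real (K + K) - real (K + i) / real (K + K)) =
      1/2 + (real i / real K + t * (real (Suc i) / real K - real i / real K)) / 2"
      using K0 by (simp add: field_simps)
    have "0 \<le> real i / real K + t * (real (Suc i) / real K - real i / real K)"
      using affine_unit_bounds(1)[OF unit_fractions(2)[OF that(1)] that(2,3)] unit_fractions(1)[OF that(1)]
      by linarith
    then show ?thesis unfolding subpath_of_def e using pq by (intro pconcat_second_half)
  qed
  have small_p: "small (?p i)" and small_q: "small (?q i)" if "i < K" for i
    using that K unfolding small_pieces_def by blast+
  have small_r: "small_pieces ?r (K + K)"
    unfolding small_pieces_def
  proof (intro conjI allI impI)
    fix i assume i: "i < K + K"
    show "small (?s i)"
    proof (cases "i < K")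
      case True
      then show ?thesis using small_cong[OF small_p sp] by blast
    next
      case False
      then obtain j where "i = K + j" "j < K" using i by (metis add_less_cancel_left le_Suc_ex not_less)
      then show ?thesis using small_cong[OF small_q sq] by blast
    qed
  qed (use K0 in simp)
  have "val ?r = chain C (ob (?r (real 0 / real (K + K)))) (\<lambda>i. small_val (?s i)) (K + K)"
    using val_eq[OF small_r] by (simp add: subdiv_val_def)
  also have "\<dots> = Comp C (chain C (ob (?r (real K / real (K + K)))) (\<lambda>i. small_val (?s (K + i))) K)
      (chain C (ob (?r (real 0 / real (K + K)))) (\<lambda>i. small_val (?s i)) K)"
    by (rule chain_add[OF C composable_small_pieces[OF small_r]])
  also have "?r (real 0 / real (K + K)) = p 0" by simp
  also have "chain C (ob (p 0)) (\<lambda>i. small_val (?s i)) K = subdiv_val p K"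
    unfolding subdiv_val_def using small_val_cong[OF small_p sp] by (intro chain_cong) blast
  also have "?r (real K / real (K + K)) = q 0"
    using pq K0 by (simp add: pconcat_def)
  also have "chain C (ob (q 0)) (\<lambda>i. small_val (?s (K + i))) K = subdiv_val q K"
    unfolding subdiv_val_def using small_val_cong[OF small_q sq] by (intro chain_cong) blast
  finally show ?thesis using val_eq K by simp
qed

lemma val_cong:
  assumes p: "p \<in> D" and eq: "\<And>t. 0 \<le> t \<Longrightarrow> t \<le> 1 \<Longrightarrow> q t = p t"
  shows "val q = val p"
proof -
  obtain N where N: "small_pieces p N" using small_pieces_exist[OF p] by metis
  let ?p = "\<lambda>i. subpath_of p (real i / real N) (real (Suc i) / real N)"
  let ?q = "\<lambda>i. subpath_of q (real i / real N) (real (Suc i) / real N)"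
  have e: "?q i t = ?p i t" if "i < N" "0 \<le> t" "t \<le> 1" for i t
    unfolding subpath_of_def
    using affine_unit_bounds[OF unit_fractions(2)[OF that(1)] that(2,3)] unit_fractions[OF that(1)]
    by (intro eq) linarith+
  have s: "small (?p i)" if "i < N" for i using that N unfolding small_pieces_def by blast
  have "small_pieces q N" using N small_cong[OF s e] unfolding small_pieces_def by blast
  moreover have "subdiv_val q N = subdiv_val p N"
    unfolding subdiv_val_def using small_val_cong[OF s e] eq[of 0] by (auto intro!: chain_cong)
  ultimately show ?thesis using val_eq N by simp
qed

text \<open>The two halves of the boundary of a small grid cell have the same value; pushing across one
  cell after the other shows that consecutive grid rows have the same value, because the outer
  vertical edges are constant.\<close>

lemma val_dihomotopic:
  assumes "dihomotopic T D X p q"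
  shows "val p = val q"
proof -
  obtain H where H: "dsquare T D X H" "\<forall>t\<in>{0..1}. H (0, t) = p t \<and> H (1, t) = q t"
      "\<forall>s\<in>{0..1}. H (s, 0) = p 0 \<and> H (s, 1) = p 1"
    using assms unfolding dihomotopic_iff by blast
  have pq: "p \<in> D" "q \<in> D" using dihomotopic_ends[OF assms] by (simp_all add: dipaths_topspace)
  have "continuous_map (top_of_set ({0..1} \<times> {0..1})) T H"
    using H(1) by (simp add: dsquare_def)
  then obtain N :: nat where N: "N > 0"
    "\<And>i j. i < N \<Longrightarrow> j < N \<Longrightarrow> \<exists>Y\<in>{X1, X2}. \<forall>s t. real i / real N \<le> s \<longrightarrow> s \<le> real (Suc i) / real N \<longrightarrow>
       real j / real N \<le> t \<longrightarrow> t \<le> real (Suc j) / real N \<longrightarrow> H (s, t) \<in> Y"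
    by (rule grid_exists) blast
  \<comment> \<open>Grid notation: \<open>row i\<close> is the path at deformation parameter
    \<open>\<tau> i\<close>, \<open>h i j\<close> its \<open>j\<close>-th piece, and
    \<open>v i j\<close> the edge that leads from row \<open>i\<close> to the next row in column
    \<open>j\<close>.\<close>
  define \<tau> where "\<tau> i = real i / real N" for i
  define row where "row i = (\<lambda>t. H (\<tau> i, t))" for i
  define h where "h i j = subpath_of (row i) (\<tau> j) (\<tau> (Suc j))" for i j
  define v where "v i j = subpath_of (\<lambda>s. H (s, \<tau> j)) (\<tau> i) (\<tau> (Suc i))" for i j
  have \<tau>: "0 \<le> \<tau> i" "\<tau> i \<le> \<tau> (Suc i)" "\<tau> (Suc i) \<le> 1" if "i < N" for i
    using unit_fractions[OF that] by (simp_all add: \<tau>_def)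
  have cell: "small (h i j) \<and> small (h (Suc i) j) \<and> small (v i j) \<and> small (v i (Suc j)) \<and>
      Comp C (small_val (v i (Suc j))) (small_val (h i j)) = Comp C (small_val (h (Suc i) j)) (small_val (v i j))"
    if ij: "i < N" "j < N" for i j
  proof -
    obtain Y where Y: "Y \<in> {X1, X2}"
      "\<And>s t. \<tau> i \<le> s \<Longrightarrow> s \<le> \<tau> (Suc i) \<Longrightarrow> \<tau> j \<le> t \<Longrightarrow> t \<le> \<tau> (Suc j) \<Longrightarrow> H (s, t) \<in> Y"
      using N(2)[OF ij] unfolding \<tau>_def by blast
    define K where "K = (\<lambda>z. H (\<tau> i + fst z * (\<tau> (Suc i) - \<tau> i), \<tau> j + snd z * (\<tau> (Suc j) - \<tau> j)))"
    have K: "dsquare T D Y K" unfolding K_def by (rule dsquare_cell[OF H(1) \<tau>[OF ij(1)] \<tau>[OF ij(2)] Y(2)])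
    have sides: "(\<lambda>t. K (0, t)) = h i j" "(\<lambda>t. K (1, t)) = h (Suc i) j"
      "(\<lambda>s. K (s, 0)) = v i j" "(\<lambda>s. K (s, 1)) = v i (Suc j)"
      by (simp_all add: K_def h_def v_def row_def subpath_of_def)
    have in_Y: "h i j \<in> dipaths D Y" "h (Suc i) j \<in> dipaths D Y" "v i j \<in> dipaths D Y" "v i (Suc j) \<in> dipaths D Y"
      using dsquare_sides[OF K, of 0] dsquare_sides[OF K, of 1] by (simp_all add: sides)
    have ends: "h i j 1 = v i (Suc j) 0" "v i j 1 = h (Suc i) j 0"
      by (simp_all add: h_def v_def row_def subpath_of_def)
    have "(pconcat (h i j) (v i (Suc j)), pconcat (v i j) (h (Suc i) j)) \<in> dhrel T D Y"
      using dsquare_boundary[OF K] by (simp add: sides)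
    then have "small_val (pconcat (h i j) (v i (Suc j))) = small_val (pconcat (v i j) (h (Suc i) j))"
      using in_Y ends by (intro small_val_dhrel[OF Y(1)] dipaths_pconcat) auto
    then show ?thesis
      using in_Y ends Y(1) small_val_pconcat[OF Y(1)] unfolding small_def by auto
  qed
  \<comment> \<open>Index \<open>N\<close> names no cell: the last row is the far side of the cells
    with index \<open>N - 1\<close>. The last column is treated in the same way.\<close>
  have small_h: "small (h i j)" if "i \<le> N" "j < N" for i j
    using that cell[of i j] cell[of "i - 1" j] N(1) by (cases "i < N") auto
  have small_v: "small (v i j)" if "i < N" "j \<le> N" for i j
    using that cell[of i j] cell[of i "j - 1"] N(1) by (cases "j < N") auto
  have pieces: "small_pieces (row i) N" if "i \<le> N" for i
    using small_h[OF that] N(1) unfolding small_pieces_def h_def \<tau>_def by blast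
  \<comment> \<open>\<open>R i n\<close> evaluates the first \<open>n\<close> pieces of row
    \<open>i\<close>; partial rows are needed because the comparison of two rows goes by induction
    on the column.\<close>
  define R where "R i n = chain C (ob (row i 0)) (\<lambda>j. small_val (h i j)) n" for i n
  have R: "R i n \<in> Arr C \<and> Dom C (R i n) = ob (row i 0) \<and> Cod C (R i n) = ob (row i (\<tau> n))"
    if "i \<le> N" "n \<le> N" for i n
  proof -
    have "composable C (\<lambda>j. ob (row i (\<tau> j))) (\<lambda>j. small_val (h i j)) n"
      using composable_small_pieces[OF pieces[OF that(1)]] that(2)
      unfolding composable_def h_def \<tau>_def by auto
    from chain_arr[OF C this] show ?thesis by (simp add: R_def \<tau>_def)
  qed
  have v_const: "small_val (v i j) = Id C (ob x)"
    if i: "i < N" and j: "j = 0 \<or> j = N" and x: "x = row i (\<tau> j)" for i j x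
  proof -
    have \<tau>j: "\<tau> j = 0 \<or> \<tau> j = 1" using j N(1) by (auto simp: \<tau>_def)
    have const: "H (s, \<tau> j) = x" if "0 \<le> s" "s \<le> 1" for s
      using \<tau>j H(3) that x \<tau>[OF i] by (auto simp: row_def)
    have "v i j t = x" if "0 \<le> t" "t \<le> 1" for t
      unfolding v_def subpath_of_def
      using affine_unit_bounds[OF \<tau>(2)[OF i] that] \<tau>[OF i] by (intro const) linarith+
    moreover have "x \<in> X"
    proof -
      have "v i j \<in> D" using small_D[OF small_v[OF i]] j by auto
      from D_subset_topspace[OF this, of 0] show ?thesis using \<open>\<And>t. 0 \<le> t \<Longrightarrow> t \<le> 1 \<Longrightarrow> v i j t = x\<close>[of 0] by simp
    qed
    ultimately show ?thesis
      using small_val_cong[OF small_const[of x], of "v i j"] small_val_const by simp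
  qed
  have push: "n \<le> N \<Longrightarrow> Comp C (small_val (v i n)) (R i n) = Comp C (R (Suc i) n) (small_val (v i 0))"
    if i: "i < N" for i n
  proof (induction n)
    case 0
    have s: "small (v i 0)" using small_v i by simp
    have "v i 0 0 = row i 0" "v i 0 1 = row (Suc i) 0"
      by (simp_all add: v_def row_def subpath_of_def \<tau>_def)
    then show ?case using small_val_arr[OF s] by (simp add: R_def cat_left_Id[OF C] cat_right_Id[OF C])
  next
    case (Suc n)
    then have n: "n < N" by simp
    have s: "small (h i n)" "small (h (Suc i) n)" "small (v i n)" "small (v i (Suc n))" "small (v i 0)"
      using cell[OF i n] small_v[OF i] by auto
    note a = s[THEN small_val_arr(1)] s[THEN small_val_arr(2)] s[THEN small_val_arr(3)]
    have e: "h i n 0 = row i (\<tau> n)" "h i n 1 = row i (\<tau> (Suc n))" "h (Suc i) n 0 = row (Suc i) (\<tau> n)"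
      "v i n 0 = row i (\<tau> n)" "v i n 1 = row (Suc i) (\<tau> n)" "v i (Suc n) 0 = row i (\<tau> (Suc n))"
      "v i 0 1 = row (Suc i) 0"
      by (simp_all add: h_def v_def row_def subpath_of_def \<tau>_def)
    have r: "R i n \<in> Arr C" "Cod C (R i n) = ob (row i (\<tau> n))"
      "R (Suc i) n \<in> Arr C" "Dom C (R (Suc i) n) = ob (row (Suc i) 0)" "Cod C (R (Suc i) n) = ob (row (Suc i) (\<tau> n))"
      using R[of i n] R[of "Suc i" n] i n by auto
    have "Comp C (small_val (v i (Suc n))) (R i (Suc n)) =
        Comp C (Comp C (small_val (v i (Suc n))) (small_val (h i n))) (R i n)"
      unfolding R_def chain.simps unfolding R_def[symmetric]
      by (rule cat_assoc[OF C]) (use a e r in simp_all)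
    also have "\<dots> = Comp C (Comp C (small_val (h (Suc i) n)) (small_val (v i n))) (R i n)"
      using cell[OF i n] by simp
    also have "\<dots> = Comp C (small_val (h (Suc i) n)) (Comp C (small_val (v i n)) (R i n))"
      by (rule cat_assoc[OF C, symmetric]) (use a e r in simp_all)
    also have "\<dots> = Comp C (small_val (h (Suc i) n)) (Comp C (R (Suc i) n) (small_val (v i 0)))"
      using Suc by simp
    also have "\<dots> = Comp C (Comp C (small_val (h (Suc i) n)) (R (Suc i) n)) (small_val (v i 0))"
      by (rule cat_assoc[OF C]) (use a e r in simp_all)
    finally show ?case by (simp add: R_def)
  qed
  have step: "R i N = R (Suc i) N" if i: "i < N" for i
  proof -
    have "row i 0 = row (Suc i) 0" "\<tau> 0 = 0"
      using H(3) \<tau>[OF i] by (auto simp: row_def \<tau>_def[of 0])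
    then show ?thesis
      using push[OF i order_refl] v_const[OF i, of N] v_const[OF i, of 0] R[of i N] R[of "Suc i" N] i
      by (simp add: cat_left_Id[OF C] cat_right_Id[OF C])
  qed
  have "i \<le> N \<Longrightarrow> R i N = R 0 N" for i
  proof (induction i)
    case (Suc i)
    then show ?case using step[of i] by simp
  qed simp
  from this[of N] have "R N N = R 0 N" by simp
  moreover have "val (row i) = R i N" if "i \<le> N" for i
    using val_eq[OF pieces[OF that]] by (simp add: subdiv_val_def R_def h_def \<tau>_def)
  ultimately have "val (row N) = val (row 0)" by simp
  \<comment> \<open>The homotopy prescribes its edges only on the unit interval, hence
    \<open>val_cong\<close> rather than equality of functions.\<close>
  moreover have "val (row 0) = val p" "val (row N) = val q"
    using H(2) N(1) pq by (auto intro!: val_cong simp: row_def \<tau>_def)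
  ultimately show ?thesis by simp
qed

lemma val_dhrel: "(p, q) \<in> dhrel T D X \<Longrightarrow> val p = val q"
  by (induction rule: dhrel_induct) (auto dest: val_dihomotopic)

text \<open>\<open>val\<close> is invariant under \<open>dhrel\<close>, so evaluating a chosen
  representative is well defined on classes. Uniqueness of mediating functors is left to the setting
  with retracts.\<close>

theorem van_Kampen_exists:
  "\<exists>F. is_functor F (fcat T D X X) C \<and>
     feq (fcat T D X1 X1) (fcomp F (incl T D X)) F1 \<and> feq (fcat T D X2 X2) (fcomp F (incl T D X)) F2"
proof -
  define F :: "('a, 'a darr, 'o, 'm) ftor" where "F = \<lparr>FObj = ob, FArr = (\<lambda>f. val (SOME p. p \<in> snd (snd f)))\<rparr>"
  have F: "FArr F (darrow T D X p) = val p" for p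
    using val_dhrel[OF some_dclass[of p T D X]] by (simp add: F_def darrow_def)
  have FO: "FObj F = ob" by (simp add: F_def)
  have "is_functor F (fcat T D X X) C"
    unfolding is_functor_def
  proof (intro conjI ballI impI)
    fix a assume "a \<in> Obj (fcat T D X X)"
    then have a: "a \<in> X" by simp
    then show "FObj F a \<in> Obj C" by (simp add: FO ob_in_Obj)
    show "FArr F (Id (fcat T D X X) a) = Id C (FObj F a)"
      using val_small[OF small_const[OF a]] small_val_const[OF a] by (simp add: F FO)
  next
    fix f assume "f \<in> Arr (fcat T D X X)"
    then obtain p where "f = darrow T D X p" "p \<in> D" by (elim Arr_fcatE) (auto simp: dipaths_topspace)
    then show "FArr F f \<in> Arr C" "Dom C (FArr F f) = FObj F (Dom (fcat T D X X) f)"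
      "Cod C (FArr F f) = FObj F (Cod (fcat T D X X) f)"
      using val_arr[of p] by (simp_all add: F FO)
  next
    fix f g assume "f \<in> Arr (fcat T D X X)" "g \<in> Arr (fcat T D X X)"
      and fg: "Cod (fcat T D X X) f = Dom (fcat T D X X) g"
    then obtain p q where "f = darrow T D X p" "p \<in> dipaths D X" "g = darrow T D X q" "q \<in> dipaths D X"
      by (metis Arr_fcatE)
    with fg show "FArr F (Comp (fcat T D X X) g f) = Comp C (FArr F g) (FArr F f)"
      using val_pconcat[of p q] by (simp add: F Comp_darrow dipaths_topspace)
  qed
  moreover have "feq (fcat T D X1 X1) (fcomp F (incl T D X)) F1"
    using X1 by (auto simp: feq_def fcomp_def FO ob_eq F val_small small_val_eq small_def elim!: Arr_fcatE)
  moreover have "feq (fcat T D X2 X2) (fcomp F (incl T D X)) F2"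
    using X2 by (auto simp: feq_def fcomp_def FO ob_eq F val_small small_val_eq small_def elim!: Arr_fcatE)
  ultimately show ?thesis by blast
qed

end

section \<open>Retracts onto full subcategories\<close>

lemma is_functor_fcomp:
  assumes "is_functor F C C'" "is_functor G C' C''"
  shows "is_functor (fcomp G F) C C''"
  using assms unfolding is_functor_def fcomp_def by simp

lemma fcomp_simps [simp]: "FObj (fcomp G F) a = FObj G (FObj F a)" "FArr (fcomp G F) f = FArr G (FArr F f)"
  by (simp_all add: fcomp_def)

lemma feqD: "feq C F G \<Longrightarrow> a \<in> Obj C \<Longrightarrow> FObj F a = FObj G a"
  "feq C F G \<Longrightarrow> f \<in> Arr C \<Longrightarrow> FArr F f = FArr G f"
  by (simp_all add: feq_def)

lemma feq_trans_sym: "feq C F G \<Longrightarrow> feq C F' G \<Longrightarrow> feq C F F'"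
  by (simp add: feq_def)

text \<open>The composition formula does not mention the object set, so composites in a full
  subcategory can be computed in the category on all points.\<close>

lemma Comp_fcat: "Comp (fcat T D Y A) = Comp (fcat T D Y Y)"
  by (simp add: fcat_def)

lemma Arr_fcat_mono: "A \<subseteq> B \<Longrightarrow> Arr (fcat T D Y A) \<subseteq> Arr (fcat T D Y B)"
  unfolding Arr_fcat by blast

lemma FArr_incl_id: "f \<in> Arr (fcat T D Y A) \<Longrightarrow> FArr (incl T D Y) f = f"
  by (elim Arr_fcatE) simp

lemma FArr_incl_incl:
  "f \<in> Arr (fcat T D Y A) \<Longrightarrow> Y \<subseteq> Z \<Longrightarrow> Z \<subseteq> W \<Longrightarrow> FArr (incl T D W) (FArr (incl T D Z) f) = FArr (incl T D W) f"
  by (elim Arr_fcatE) (simp add: order_trans)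

text \<open>What remains of a future retract onto a full subcategory when the universal property of the
  unit is dropped; such retracts are closed under composition.\<close>

definition unital_retract :: "'a topology \<Rightarrow> (real \<Rightarrow> 'a) set \<Rightarrow> 'a set \<Rightarrow> 'a set
    \<Rightarrow> ('a, 'a darr, 'a, 'a darr) ftor \<Rightarrow> ('a \<Rightarrow> 'a darr) \<Rightarrow> bool" where
  "unital_retract T D Y A R \<epsilon> \<longleftrightarrow>
     is_functor R (fcat T D Y Y) (fcat T D Y A) \<and>
     (\<forall>x\<in>Y. \<epsilon> x \<in> Arr (fcat T D Y Y) \<and> fst (\<epsilon> x) = x \<and> fst (snd (\<epsilon> x)) = FObj R x) \<and>
     (\<forall>f\<in>Arr (fcat T D Y Y). Comp (fcat T D Y Y) (\<epsilon> (fst (snd f))) f =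
        Comp (fcat T D Y Y) (FArr R f) (\<epsilon> (fst f))) \<and>
     (\<forall>a\<in>A. \<epsilon> a = Id (fcat T D Y Y) a)"

lemma
  assumes "unital_retract T D Y A R \<epsilon>"
  shows unital_retract_functor: "is_functor R (fcat T D Y Y) (fcat T D Y A)"
    and unital_retract_unit: "x \<in> Y \<Longrightarrow> \<epsilon> x \<in> Arr (fcat T D Y Y)" "x \<in> Y \<Longrightarrow> fst (\<epsilon> x) = x"
      "x \<in> Y \<Longrightarrow> fst (snd (\<epsilon> x)) = FObj R x"
    and unital_retract_natural: "f \<in> Arr (fcat T D Y Y) \<Longrightarrow>
      Comp (fcat T D Y Y) (\<epsilon> (fst (snd f))) f = Comp (fcat T D Y Y) (FArr R f) (\<epsilon> (fst f))"
    and unital_retract_Id: "a \<in> A \<Longrightarrow> \<epsilon> a = Id (fcat T D Y Y) a"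
  using assms unfolding unital_retract_def by blast+

lemma unital_retract_future_retract:
  assumes "future_retract (fcat T D Y Y) (fcat T D Y A) (incl T D Y) R \<epsilon>"
  shows "unital_retract T D Y A R \<epsilon>"
  using assms FArr_incl_id[OF functor_Arr, of R "fcat T D Y Y" T D Y A]
  unfolding future_retract_def unital_retract_def by simp

context d_space
begin

text \<open>For an arrow \<open>f\<close> between points of \<open>A\<close> both units in the
  naturality square are identities, and the square reads \<open>f = FArr R f\<close>. On objects one
  compares the codomain of the unit with that of the identity.\<close>

lemma unital_retract_fixes:
  assumes R: "unital_retract T D Y A R \<epsilon>" and AY: "A \<subseteq> Y" "Y \<subseteq> topspace T"
  shows "a \<in> A \<Longrightarrow> FObj R a = a" "f \<in> Arr (fcat T D Y A) \<Longrightarrow> FArr R f = f"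
proof -
  have ob: "FObj R a = a" if "a \<in> A" for a
    using unital_retract_unit(3)[OF R, of a] unital_retract_Id[OF R that] that AY by auto
  show "a \<in> A \<Longrightarrow> FObj R a = a" by (rule ob)
  assume f: "f \<in> Arr (fcat T D Y A)"
  then have fY: "f \<in> Arr (fcat T D Y Y)" using Arr_fcat_mono[OF AY(1)] by blast
  have ends: "fst f \<in> A" "fst (snd f) \<in> A" using f by (auto elim: Arr_fcatE)
  note cat = is_category_fcat[OF order_refl AY(2)]
  have Rf: "FArr R f \<in> Arr (fcat T D Y Y)" "fst (FArr R f) = fst f"
    using functor_Arr[OF unital_retract_functor[OF R] fY] Arr_fcat_mono[OF AY(1)]
      functor_Dom[OF unital_retract_functor[OF R] fY] ob[OF ends(1)] by auto
  have "f = Comp (fcat T D Y Y) (\<epsilon> (fst (snd f))) f"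
    using cat_left_Id[OF cat fY] unital_retract_Id[OF R ends(2)] by simp
  also have "\<dots> = Comp (fcat T D Y Y) (FArr R f) (\<epsilon> (fst f))"
    by (rule unital_retract_natural[OF R fY])
  also have "\<dots> = FArr R f"
    using cat_right_Id[OF cat Rf(1)] Rf(2) unital_retract_Id[OF R ends(1)] by simp
  finally show "FArr R f = f" by simp
qed

text \<open>Naturality of the composite unit is the pasting of the squares of
  \<open>\<theta>\<close> and \<open>\<eta>\<close>. On \<open>A\<close> it is an identity because
  \<open>A \<subseteq> B\<close>, so \<open>Q\<close> fixes the point and both factors are
  identities.\<close>

lemma unital_retract_comp:
  assumes Q: "unital_retract T D Y B Q \<theta>"
    and P: "future_retract (fcat T D Y B) (fcat T D Y A) (incl T D Y) P \<eta>"
    and sub: "A \<subseteq> B" "B \<subseteq> Y" "Y \<subseteq> topspace T"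
  shows "unital_retract T D Y A (fcomp P Q) (\<lambda>x. Comp (fcat T D Y Y) (\<eta> (FObj Q x)) (\<theta> x))"
proof -
  let ?C = "fcat T D Y Y"
  note cat = is_category_fcat[OF order_refl sub(3)]
  note fQ = unital_retract_functor[OF Q]
  have fP: "is_functor P (fcat T D Y B) (fcat T D Y A)" using P by (simp add: future_retract_def)
  have \<eta>: "\<eta> b \<in> Arr ?C" "fst (\<eta> b) = b" "fst (snd (\<eta> b)) = FObj P b" if "b \<in> B" for b
    using P that Arr_fcat_mono[OF sub(2), of T D Y] by (auto simp: future_retract_def)
  have nat\<eta>: "Comp ?C (\<eta> (fst (snd f))) f = Comp ?C (FArr P f) (\<eta> (fst f))" if "f \<in> Arr (fcat T D Y B)" for f
    using P that FArr_incl_id[OF functor_Arr[OF fP that]]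
    by (simp add: future_retract_def Comp_fcat[of T D Y B])
  have QB: "FObj Q x \<in> B" if "x \<in> Y" for x using functor_Obj[OF fQ, of x] that by simp
  note \<theta> = unital_retract_unit[OF Q]
  show ?thesis
    unfolding unital_retract_def
  proof (intro conjI ballI)
    show "is_functor (fcomp P Q) ?C (fcat T D Y A)" by (rule is_functor_fcomp[OF fQ fP])
  next
    fix x assume x: "x \<in> Y"
    show "Comp ?C (\<eta> (FObj Q x)) (\<theta> x) \<in> Arr ?C" "fst (Comp ?C (\<eta> (FObj Q x)) (\<theta> x)) = x"
      "fst (snd (Comp ?C (\<eta> (FObj Q x)) (\<theta> x))) = FObj (fcomp P Q) x"
      using cat_Comp[OF cat \<theta>(1)[OF x] \<eta>(1)[OF QB[OF x]]] \<theta>[OF x] \<eta>[OF QB[OF x]] by simp_all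
  next
    fix f assume f: "f \<in> Arr ?C"
    then have x: "fst f \<in> Y" and y: "fst (snd f) \<in> Y" by (auto elim: Arr_fcatE)
    have Qf: "FArr Q f \<in> Arr (fcat T D Y B)" "fst (FArr Q f) = FObj Q (fst f)"
      "fst (snd (FArr Q f)) = FObj Q (fst (snd f))"
      using functor_Arr[OF fQ f] functor_Dom[OF fQ f] functor_Cod[OF fQ f] by simp_all
    have Qf': "FArr Q f \<in> Arr ?C" using Qf(1) Arr_fcat_mono[OF sub(2)] by blast
    have PQf: "FArr P (FArr Q f) \<in> Arr ?C" "fst (FArr P (FArr Q f)) = FObj P (FObj Q (fst f))"
      using functor_Arr[OF fP Qf(1)] functor_Dom[OF fP Qf(1)] Qf(2)
        Arr_fcat_mono[OF order_trans[OF sub(1,2)]] by auto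
    note a = \<theta>[OF x] \<theta>[OF y] \<eta>[OF QB[OF x]] \<eta>[OF QB[OF y]] Qf(2,3) Qf' PQf f
    have "Comp ?C (Comp ?C (\<eta> (FObj Q (fst (snd f)))) (\<theta> (fst (snd f)))) f =
        Comp ?C (\<eta> (FObj Q (fst (snd f)))) (Comp ?C (\<theta> (fst (snd f))) f)"
      by (rule cat_assoc[OF cat, symmetric]) (use a in simp_all)
    also have "Comp ?C (\<theta> (fst (snd f))) f = Comp ?C (FArr Q f) (\<theta> (fst f))"
      by (rule unital_retract_natural[OF Q f])
    also have "Comp ?C (\<eta> (FObj Q (fst (snd f)))) (Comp ?C (FArr Q f) (\<theta> (fst f))) =
        Comp ?C (Comp ?C (\<eta> (FObj Q (fst (snd f)))) (FArr Q f)) (\<theta> (fst f))"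
      by (rule cat_assoc[OF cat]) (use a in simp_all)
    also have "Comp ?C (\<eta> (FObj Q (fst (snd f)))) (FArr Q f) =
        Comp ?C (FArr P (FArr Q f)) (\<eta> (FObj Q (fst f)))"
      using nat\<eta>[OF Qf(1)] Qf(2,3) by simp
    also have "Comp ?C (Comp ?C (FArr P (FArr Q f)) (\<eta> (FObj Q (fst f)))) (\<theta> (fst f)) =
        Comp ?C (FArr P (FArr Q f)) (Comp ?C (\<eta> (FObj Q (fst f))) (\<theta> (fst f)))"
      by (rule cat_assoc[OF cat, symmetric]) (use a in simp_all)
    finally show "Comp ?C (Comp ?C (\<eta> (FObj Q (fst (snd f)))) (\<theta> (fst (snd f)))) f =
        Comp ?C (FArr (fcomp P Q) f) (Comp ?C (\<eta> (FObj Q (fst f))) (\<theta> (fst f)))" by simp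
  next
    fix a assume a: "a \<in> A"
    then have aB: "a \<in> B" and aY: "a \<in> Y" using sub by auto
    have "\<eta> a = Id ?C a" using P a by (auto simp: future_retract_def)
    moreover have "FObj Q a = a" by (rule unital_retract_fixes(1)[OF Q sub(2,3) aB])
    ultimately show "Comp ?C (\<eta> (FObj Q a)) (\<theta> a) = Id ?C a"
      using unital_retract_Id[OF Q aB] cat_left_Id[OF cat cat_Id(1)[OF cat]] aY by simp
  qed
qed

text \<open>Compatibility along one inclusion survives composition of retracts; for the units this
  is functoriality of \<open>incl\<close> on the composite. The general
  \<open>Y \<subseteq> Z\<close> covers the inclusions of the intersection into both pieces.\<close>

lemma compatible_retracts_comp:
  assumes Y: "Y \<subseteq> Z" and B: "B \<subseteq> Y"
    and Q: "unital_retract T D Y B Q \<theta>"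
    and P: "future_retract (fcat T D Y B) (fcat T D Y A) (incl T D Y) P \<eta>"
    and Q_comm: "feq (fcat T D Y Y) (fcomp Q' (incl T D Z)) (fcomp (incl T D Z) Q)"
    and \<theta>_comm: "\<forall>x\<in>Y. FArr (incl T D Z) (\<theta> x) = \<theta>' x"
    and P_comm: "feq (fcat T D Y B) (fcomp P' (incl T D Z)) (fcomp (incl T D Z) P)"
    and \<eta>_comm: "\<forall>x\<in>B. FArr (incl T D Z) (\<eta> x) = \<eta>' x"
  shows "feq (fcat T D Y Y) (fcomp (fcomp P' Q') (incl T D Z)) (fcomp (incl T D Z) (fcomp P Q))"
    and "\<forall>x\<in>Y. FArr (incl T D Z) (Comp (fcat T D Y Y) (\<eta> (FObj Q x)) (\<theta> x)) =
           Comp (fcat T D Z Z) (\<eta>' (FObj Q' x)) (\<theta>' x)"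
proof -
  note fQ = unital_retract_functor[OF Q]
  show "feq (fcat T D Y Y) (fcomp (fcomp P' Q') (incl T D Z)) (fcomp (incl T D Z) (fcomp P Q))"
    using Q_comm P_comm functor_Obj[OF fQ] functor_Arr[OF fQ] by (simp add: feq_def)
  show "\<forall>x\<in>Y. FArr (incl T D Z) (Comp (fcat T D Y Y) (\<eta> (FObj Q x)) (\<theta> x)) =
           Comp (fcat T D Z Z) (\<eta>' (FObj Q' x)) (\<theta>' x)"
  proof
    fix x assume x: "x \<in> Y"
    have QB: "FObj Q x \<in> B" using functor_Obj[OF fQ, of x] x by simp
    have \<eta>: "\<eta> (FObj Q x) \<in> Arr (fcat T D Y Y)" "fst (\<eta> (FObj Q x)) = FObj Q x"
      using P QB Arr_fcat_mono[OF B, of T D Y] by (auto simp: future_retract_def)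
    have "FObj Q' x = FObj Q x" using feqD(1)[OF Q_comm, of x] x by simp
    then show "FArr (incl T D Z) (Comp (fcat T D Y Y) (\<eta> (FObj Q x)) (\<theta> x)) =
           Comp (fcat T D Z Z) (\<eta>' (FObj Q' x)) (\<theta>' x)"
      using functor_Comp[OF is_functor_incl[OF Y Y] unital_retract_unit(1)[OF Q x] \<eta>(1)]
        \<eta>(2) unital_retract_unit(3)[OF Q x] \<theta>_comm \<eta>_comm x QB by simp
  qed
qed

end

section \<open>Transfer of the pushout property along compatible retracts\<close>

locale d_retract = d_cover T D X1 X2
  for T :: "'a topology" and D :: "(real \<Rightarrow> 'a) set" and X1 X2 :: "'a set" +
  fixes A1 A2 :: "'a set" and R0 R1 R2 :: "('a, 'a darr, 'a, 'a darr) ftor"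
    and \<epsilon>0 \<epsilon>1 \<epsilon>2 :: "'a \<Rightarrow> 'a darr"
  assumes A1: "A1 \<subseteq> X1" and A2: "A2 \<subseteq> X2"
    and R0: "unital_retract T D (X1 \<inter> X2) (A1 \<inter> A2) R0 \<epsilon>0"
    and R1: "unital_retract T D X1 A1 R1 \<epsilon>1" and R2: "unital_retract T D X2 A2 R2 \<epsilon>2"
    and R1_comm: "feq (fcat T D (X1 \<inter> X2) (X1 \<inter> X2)) (fcomp R1 (incl T D X1)) (fcomp (incl T D X1) R0)"
    and R2_comm: "feq (fcat T D (X1 \<inter> X2) (X1 \<inter> X2)) (fcomp R2 (incl T D X2)) (fcomp (incl T D X2) R0)"
    and \<epsilon>1_comm: "\<forall>x\<in>X1 \<inter> X2. FArr (incl T D X1) (\<epsilon>0 x) = \<epsilon>1 x"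
    and \<epsilon>2_comm: "\<forall>x\<in>X1 \<inter> X2. FArr (incl T D X2) (\<epsilon>0 x) = \<epsilon>2 x"
begin

text \<open>On the overlap \<open>R1\<close> and \<open>R2\<close> both factor through
  \<open>R0\<close>, which lands in \<open>A1 \<inter> A2\<close>, where \<open>u1\<close> and
  \<open>u2\<close> agree. So \<open>u1\<close> after \<open>R1\<close> and \<open>u2\<close> after
  \<open>R2\<close> form a cocone on all points.\<close>

lemma retract_cocone:
  assumes C: "is_category C"
    and u1: "is_functor u1 (fcat T D X1 A1) C" and u2: "is_functor u2 (fcat T D X2 A2) C"
    and u12: "feq (fcat T D (X1 \<inter> X2) (A1 \<inter> A2)) (fcomp u1 (incl T D X1)) (fcomp u2 (incl T D X2))"
  obtains V where "is_functor V (fcat T D X X) C"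
    "feq (fcat T D X1 X1) (fcomp V (incl T D X)) (fcomp u1 R1)"
    "feq (fcat T D X2 X2) (fcomp V (incl T D X)) (fcomp u2 R2)"
proof -
  note f0 = unital_retract_functor[OF R0]
  interpret d_cocone T D X1 X2 C "fcomp u1 R1" "fcomp u2 R2"
  proof
    show "is_functor (fcomp u1 R1) (fcat T D X1 X1) C" "is_functor (fcomp u2 R2) (fcat T D X2 X2) C"
      using is_functor_fcomp unital_retract_functor R1 R2 u1 u2 by metis+
    show "feq (fcat T D (X1 \<inter> X2) (X1 \<inter> X2)) (fcomp (fcomp u1 R1) (incl T D X1)) (fcomp (fcomp u2 R2) (incl T D X2))"
      using R1_comm R2_comm u12 functor_Obj[OF f0] functor_Arr[OF f0] by (simp add: feq_def)
  qed (rule C)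
  show ?thesis using that van_Kampen_exists by blast
qed

text \<open>The mediating functor on all points is restricted to \<open>A1 \<union> A2\<close>. On
  arrows between points of \<open>A1\<close> or of \<open>A2\<close> the retract is the identity, so
  the restriction extends \<open>u1\<close> and \<open>u2\<close> themselves.\<close>

theorem retract_pushout_exists:
  assumes C: "is_category C"
    and u1: "is_functor u1 (fcat T D X1 A1) C" and u2: "is_functor u2 (fcat T D X2 A2) C"
    and u12: "feq (fcat T D (X1 \<inter> X2) (A1 \<inter> A2)) (fcomp u1 (incl T D X1)) (fcomp u2 (incl T D X2))"
  obtains u where "is_functor u (fcat T D X (A1 \<union> A2)) C"
    "feq (fcat T D X1 A1) (fcomp u (incl T D X)) u1"
    "feq (fcat T D X2 A2) (fcomp u (incl T D X)) u2"
proof -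
  obtain V where V: "is_functor V (fcat T D X X) C"
    "feq (fcat T D X1 X1) (fcomp V (incl T D X)) (fcomp u1 R1)"
    "feq (fcat T D X2 X2) (fcomp V (incl T D X)) (fcomp u2 R2)"
    by (rule retract_cocone[OF C u1 u2 u12])
  have restrict: "feq (fcat T D Y A) (fcomp V (incl T D X)) u"
    if "feq (fcat T D Y Y) (fcomp V (incl T D X)) (fcomp u R)" "unital_retract T D Y A R \<epsilon>"
      "A \<subseteq> Y" "Y \<subseteq> X" for Y A u R \<epsilon>
    unfolding feq_def
  proof (intro conjI ballI)
    fix a assume "a \<in> Obj (fcat T D Y A)"
    then show "FObj (fcomp V (incl T D X)) a = FObj u a"
      using feqD(1)[OF that(1), of a] unital_retract_fixes(1)[OF that(2-4), of a] that(3) by auto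
  next
    fix f assume f: "f \<in> Arr (fcat T D Y A)"
    then have "f \<in> Arr (fcat T D Y Y)" using Arr_fcat_mono[OF that(3)] by blast
    then show "FArr (fcomp V (incl T D X)) f = FArr u f"
      using feqD(2)[OF that(1), of f] unital_retract_fixes(2)[OF that(2-4) f] by simp
  qed
  have "is_functor (fcomp V (incl T D X)) (fcat T D X (A1 \<union> A2)) C"
    using A1 A2 X1 X2 by (intro is_functor_fcomp[OF is_functor_incl V(1)]) auto
  moreover have "feq (fcat T D Y A) (fcomp (fcomp V (incl T D X)) (incl T D X)) u"
    if "feq (fcat T D Y A) (fcomp V (incl T D X)) u" "Y \<subseteq> X" for Y A u
    using that FArr_incl_incl[of _ T D Y A X X] by (auto simp: feq_def)
  ultimately show ?thesis
    using that restrict[OF V(2) R1 A1 X1] restrict[OF V(3) R2 A2 X2] X1 X2 by metis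
qed

text \<open>The retracts glue to a functor on the whole space with a natural unit, and naturality against
  an identity unit forces this functor to fix every arrow between points of \<open>A1 \<union> A2\<close>.\<close>

lemma glued_retract:
  obtains R where "is_functor R (fcat T D X X) (fcat T D X (A1 \<union> A2))"
    "feq (fcat T D X1 X1) (fcomp R (incl T D X)) (fcomp (incl T D X) R1)"
    "feq (fcat T D X2 X2) (fcomp R (incl T D X)) (fcomp (incl T D X) R2)"
    "\<And>f. f \<in> Arr (fcat T D X (A1 \<union> A2)) \<Longrightarrow> FArr R f = f"
proof -
  let ?A = "A1 \<union> A2" and ?C = "fcat T D X X"
  have AX: "?A \<subseteq> X" using A1 A2 X1 X2 by blast
  note cat = is_category_fcat[OF order_refl order_refl]
  \<comment> \<open>Existence is applied to the cocone of inclusions into the category on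
    \<open>A1 \<union> A2\<close>; its mediating functor is the glued retract.\<close>
  obtain R where R: "is_functor R ?C (fcat T D X ?A)"
    "feq (fcat T D X1 X1) (fcomp R (incl T D X)) (fcomp (incl T D X) R1)"
    "feq (fcat T D X2 X2) (fcomp R (incl T D X)) (fcomp (incl T D X) R2)"
  proof (rule retract_cocone)
    show "is_category (fcat T D X ?A)" by (rule is_category_fcat[OF AX order_refl])
    show "is_functor (incl T D X) (fcat T D X1 A1) (fcat T D X ?A)" "is_functor (incl T D X) (fcat T D X2 A2) (fcat T D X ?A)"
      using X1 X2 by (auto intro: is_functor_incl)
    show "feq (fcat T D (X1 \<inter> X2) (A1 \<inter> A2)) (fcomp (incl T D X) (incl T D X1)) (fcomp (incl T D X) (incl T D X2))"
      using X1 X2 by (auto simp: feq_def FArr_incl_incl)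
  qed
  \<comment> \<open>The preference for \<open>\<epsilon>1\<close> is immaterial: on the overlap both
    units are images of \<open>\<epsilon>0\<close>.\<close>
  define \<epsilon> where "\<epsilon> x = FArr (incl T D X) (if x \<in> X1 then \<epsilon>1 x else \<epsilon>2 x)" for x
  have \<epsilon>_eq: "\<epsilon> x = FArr (incl T D X) (\<epsilon>1 x)" if "x \<in> X1" for x using that by (simp add: \<epsilon>_def)
  have \<epsilon>_eq2: "\<epsilon> x = FArr (incl T D X) (\<epsilon>2 x)" if x: "x \<in> X2" for x
  proof (cases "x \<in> X1")
    case True
    then have x0: "x \<in> X1 \<inter> X2" using x by simp
    then show ?thesis
      using \<epsilon>1_comm \<epsilon>2_comm FArr_incl_incl[OF unital_retract_unit(1)[OF R0 x0], of X1 X]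
        FArr_incl_incl[OF unital_retract_unit(1)[OF R0 x0], of X2 X] X1 X2 \<epsilon>_eq[OF True] by auto
  qed (simp add: \<epsilon>_def)
  \<comment> \<open>Packages the local retract, its unit and their relation to the glued data, so
    that the two pieces need no separate treatment.\<close>
  have piece: "\<exists>A R' \<epsilon>'. unital_retract T D Y A R' \<epsilon>' \<and> A \<subseteq> Y \<and> Y \<subseteq> X \<and>
      feq (fcat T D Y Y) (fcomp R (incl T D X)) (fcomp (incl T D X) R') \<and>
      (\<forall>x\<in>Y. \<epsilon> x = FArr (incl T D X) (\<epsilon>' x))" if "Y \<in> {X1, X2}" for Y
  proof (cases "Y = X1")
    case True
    then show ?thesis using R1 A1 X1 R(2) \<epsilon>_eq by (intro exI[of _ A1] exI[of _ R1] exI[of _ \<epsilon>1]) simp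
  next
    case False
    then have "Y = X2" using that by simp
    then show ?thesis using R2 A2 X2 R(3) \<epsilon>_eq2 by (intro exI[of _ A2] exI[of _ R2] exI[of _ \<epsilon>2]) simp
  qed
  have \<epsilon>: "\<epsilon> x \<in> Arr ?C" "fst (\<epsilon> x) = x" "fst (snd (\<epsilon> x)) = FObj R x" if "x \<in> X" for x
  proof -
    have "x \<in> X1 \<union> X2" using that topspace_covered by (rule subsetD[rotated])
    then obtain Y where Y: "Y \<in> {X1, X2}" "x \<in> Y" by blast
    from piece[OF Y(1)] obtain A R' \<epsilon>' where R': "unital_retract T D Y A R' \<epsilon>'" "Y \<subseteq> X"
      "feq (fcat T D Y Y) (fcomp R (incl T D X)) (fcomp (incl T D X) R')" "\<epsilon> x = FArr (incl T D X) (\<epsilon>' x)"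
      using Y(2) by (elim exE conjE) simp
    note u = unital_retract_unit[OF R'(1) Y(2)]
    note i = is_functor_incl[OF R'(2) R'(2)]
    show "\<epsilon> x \<in> Arr ?C" "fst (\<epsilon> x) = x" "fst (snd (\<epsilon> x)) = FObj R x"
      using functor_Arr[OF i u(1)] functor_Dom[OF i u(1)] functor_Cod[OF i u(1)] u(2,3) R'(4)
        feqD(1)[OF R'(3), of x] Y(2) by simp_all
  qed
  have RC: "FArr R f \<in> Arr ?C" "fst (FArr R f) = FObj R (fst f)" "fst (snd (FArr R f)) = FObj R (fst (snd f))"
    if "f \<in> Arr ?C" for f
    using functor_Arr[OF R(1) that] functor_Dom[OF R(1) that] functor_Cod[OF R(1) that] Arr_fcat_mono[OF AX] by auto
  \<comment> \<open>For a small arrow the square is the image of the naturality square in its piece;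
    for composites two squares are pasted.\<close>
  have natural: "Comp ?C (\<epsilon> (fst (snd f))) f = Comp ?C (FArr R f) (\<epsilon> (fst f))" if "f \<in> Arr ?C" for f
    using that
  proof (induction rule: darrow_induct)
    case (small p)
    then obtain Y where Y: "Y \<in> {X1, X2}" "p \<in> dipaths D Y" by (auto simp: small_def)
    from piece[OF Y(1)] obtain A R' \<epsilon>' where R': "unital_retract T D Y A R' \<epsilon>'" "A \<subseteq> Y" "Y \<subseteq> X"
      "feq (fcat T D Y Y) (fcomp R (incl T D X)) (fcomp (incl T D X) R')"
      "\<And>x. x \<in> Y \<Longrightarrow> \<epsilon> x = FArr (incl T D X) (\<epsilon>' x)"
      by (elim exE conjE) simp
    let ?g = "darrow T D Y p"
    have g: "?g \<in> Arr (fcat T D Y Y)" and p01: "p 0 \<in> Y" "p 1 \<in> Y"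
      using dipaths_ends[OF Y(2)] Y(2) by (auto intro!: darrow_in_Arr)
    note i = is_functor_incl[OF R'(3) R'(3)]
    have f: "darrow T D X p = FArr (incl T D X) ?g" using R'(3) by simp
    have Rf: "FArr R (darrow T D X p) = FArr (incl T D X) (FArr R' ?g)"
      using feqD(2)[OF R'(4) g] R'(3) by simp
    have R'g: "FArr R' ?g \<in> Arr (fcat T D Y Y)" "fst (FArr R' ?g) = FObj R' (p 0)"
      using functor_Arr[OF unital_retract_functor[OF R'(1)] g] Arr_fcat_mono[OF R'(2)]
        functor_Dom[OF unital_retract_functor[OF R'(1)] g] by auto
    note u = unital_retract_unit[OF R'(1)]
    have "Comp ?C (\<epsilon> (p 1)) (FArr (incl T D X) ?g) =
        FArr (incl T D X) (Comp (fcat T D Y Y) (\<epsilon>' (p 1)) ?g)"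
      using functor_Comp[OF i g u(1)[OF p01(2)]] u(2)[OF p01(2)] R'(5)[OF p01(2)] by simp
    also have "Comp (fcat T D Y Y) (\<epsilon>' (p 1)) ?g = Comp (fcat T D Y Y) (FArr R' ?g) (\<epsilon>' (p 0))"
      using unital_retract_natural[OF R'(1) g] by simp
    also have "FArr (incl T D X) \<dots> = Comp ?C (FArr (incl T D X) (FArr R' ?g)) (\<epsilon> (p 0))"
      using functor_Comp[OF i u(1)[OF p01(1)] R'g(1)] u(3)[OF p01(1)] R'g(2) R'(5)[OF p01(1)] by simp
    finally show ?case unfolding Rf f[symmetric] by simp
  next
    case (Comp f g)
    have ob: "fst f \<in> X" "fst g \<in> X" "fst (snd g) \<in> X"
      using Comp.hyps(1,2) by (auto elim!: Arr_fcatE dest!: dipaths_ends)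
    note c = cat_Comp[OF cat Comp.hyps(1,2)]
    note a = \<epsilon>[OF ob(1)] \<epsilon>[OF ob(2)] \<epsilon>[OF ob(3)] RC[OF Comp.hyps(1)] RC[OF Comp.hyps(2)] Comp.hyps
    have "Comp ?C (\<epsilon> (fst (snd g))) (Comp ?C g f) = Comp ?C (Comp ?C (\<epsilon> (fst (snd g))) g) f"
      by (rule cat_assoc[OF cat]) (use a in simp_all)
    also have "\<dots> = Comp ?C (Comp ?C (FArr R g) (\<epsilon> (fst g))) f" using Comp.IH(2) by simp
    also have "\<dots> = Comp ?C (FArr R g) (Comp ?C (\<epsilon> (fst g)) f)"
      by (rule cat_assoc[OF cat, symmetric]) (use a in simp_all)
    also have "\<dots> = Comp ?C (FArr R g) (Comp ?C (FArr R f) (\<epsilon> (fst f)))" using Comp.IH(1) Comp.hyps(3) by simp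
    also have "\<dots> = Comp ?C (Comp ?C (FArr R g) (FArr R f)) (\<epsilon> (fst f))"
      by (rule cat_assoc[OF cat]) (use a in simp_all)
    also have "Comp ?C (FArr R g) (FArr R f) = FArr R (Comp ?C g f)"
      using functor_Comp[OF R(1) Comp.hyps(1,2)] Comp.hyps(3) by (simp add: Comp_fcat[of T D X ?A])
    finally show ?case using c(2,3) Comp.hyps(3) by simp
  qed
  have \<epsilon>_Id: "\<epsilon> a = Id ?C a" if "a \<in> ?A" for a
  proof -
    have "\<epsilon> a = FArr (incl T D X) (Id (fcat T D Y Y) a)" "a \<in> Y" "Y \<subseteq> X"
      if "a \<in> A" "A \<subseteq> Y" "unital_retract T D Y A R' \<epsilon>'" "Y \<subseteq> X" "\<And>x. x \<in> Y \<Longrightarrow> \<epsilon> x = FArr (incl T D X) (\<epsilon>' x)"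
      for A Y R' \<epsilon>' using that unital_retract_Id[OF that(3,1)] by auto
    from this[OF _ A1 R1 X1 \<epsilon>_eq] this[OF _ A2 R2 X2 \<epsilon>_eq2] that show ?thesis
      using X1 X2 by auto
  qed
  have "FArr R f = f" if f: "f \<in> Arr (fcat T D X ?A)" for f
  proof -
    have "unital_retract T D X ?A R \<epsilon>"
      unfolding unital_retract_def using R(1) \<epsilon> natural \<epsilon>_Id by blast
    then show ?thesis using unital_retract_fixes(2) AX f by blast
  qed
  then show ?thesis using that R by blast
qed

text \<open>The glued retract sends a small arrow to an arrow coming from \<open>A1\<close> in
  \<open>X1\<close> or from \<open>A2\<close> in \<open>X2\<close>, where \<open>u\<close> and
  \<open>u'\<close> agree by assumption. Hence they agree on everything in the image of
  \<open>R\<close>, and \<open>R\<close> fixes all arrows of the subcategory.\<close>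

theorem retract_pushout_unique:
  assumes u: "is_functor u (fcat T D X (A1 \<union> A2)) C" and u': "is_functor u' (fcat T D X (A1 \<union> A2)) C"
    and eq1: "feq (fcat T D X1 A1) (fcomp u (incl T D X)) (fcomp u' (incl T D X))"
    and eq2: "feq (fcat T D X2 A2) (fcomp u (incl T D X)) (fcomp u' (incl T D X))"
  shows "feq (fcat T D X (A1 \<union> A2)) u u'"
  unfolding feq_def
proof (intro conjI ballI)
  fix a assume "a \<in> Obj (fcat T D X (A1 \<union> A2))"
  then show "FObj u a = FObj u' a" using feqD(1)[OF eq1, of a] feqD(1)[OF eq2, of a] by auto
next
  fix f assume f: "f \<in> Arr (fcat T D X (A1 \<union> A2))"
  obtain R where R: "is_functor R (fcat T D X X) (fcat T D X (A1 \<union> A2))"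
    "feq (fcat T D X1 X1) (fcomp R (incl T D X)) (fcomp (incl T D X) R1)"
    "feq (fcat T D X2 X2) (fcomp R (incl T D X)) (fcomp (incl T D X) R2)"
    "\<And>f. f \<in> Arr (fcat T D X (A1 \<union> A2)) \<Longrightarrow> FArr R f = f"
    by (rule glued_retract) blast
  have "f \<in> Arr (fcat T D X X)" using f Arr_fcat_mono[of "A1 \<union> A2" X T D X] A1 A2 X1 X2 by blast
  \<comment> \<open>The claim is about \<open>FArr R f\<close> because the factors produced by the
    induction may have endpoints outside \<open>A1 \<union> A2\<close>, where \<open>u\<close> and
    \<open>u'\<close> have no meaning.\<close>
  then have "FArr u (FArr R f) = FArr u' (FArr R f)"
  proof (induction rule: darrow_induct)
    case (small p)
    have *: "FArr u (FArr R (darrow T D X p)) = FArr u' (FArr R (darrow T D X p))"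
      if "p \<in> dipaths D Y" "Y \<subseteq> X" "unital_retract T D Y A R' \<epsilon>'"
        "feq (fcat T D Y Y) (fcomp R (incl T D X)) (fcomp (incl T D X) R')"
        "feq (fcat T D Y A) (fcomp u (incl T D X)) (fcomp u' (incl T D X))" for Y A R' \<epsilon>'
    proof -
      have g: "darrow T D Y p \<in> Arr (fcat T D Y Y)"
        using dipaths_ends[OF that(1)] that(1) by (auto intro!: darrow_in_Arr)
      have "FArr R (darrow T D X p) = FArr (incl T D X) (FArr R' (darrow T D Y p))"
        using feqD(2)[OF that(4) g] that(2) by simp
      then show ?thesis
        using feqD(2)[OF that(5) functor_Arr[OF unital_retract_functor[OF that(3)] g]] by simp
    qed
    from small consider "p \<in> dipaths D X1" | "p \<in> dipaths D X2" by (auto simp: small_def)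
    then show ?case using *[OF _ X1 R1 R(2) eq1] *[OF _ X2 R2 R(3) eq2] by cases blast+
  next
    case (Comp f g)
    note fg = functor_Arr[OF R(1) Comp.hyps(1)] functor_Arr[OF R(1) Comp.hyps(2)]
    have m: "Cod (fcat T D X (A1 \<union> A2)) (FArr R f) = Dom (fcat T D X (A1 \<union> A2)) (FArr R g)"
      using functor_Cod[OF R(1) Comp.hyps(1)] functor_Dom[OF R(1) Comp.hyps(2)] Comp.hyps(3) by simp
    show ?case
      using functor_Comp[OF R(1) Comp.hyps(1,2)] Comp.IH Comp.hyps(3) functor_Comp[OF u fg m] functor_Comp[OF u' fg m] by simp
  qed
  then show "FArr u f = FArr u' f" using R(4)[OF f] by simp
qed

end

section \<open>The pushout in the arrow category\<close>

theorem theorem4p4: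
  fixes T :: "'a topology" and D :: "(real \<Rightarrow> 'a) set"
    and X1 X2 A0 A1 A2 B0 B1 B2 :: "'a set"
    and Q0 Q1 Q2 P0 P1 P2 :: "('a, 'a darr, 'a, 'a darr) ftor"
    and \<theta>0 \<theta>1 \<theta>2 \<eta>0 \<eta>1 \<eta>2 :: "'a \<Rightarrow> 'a darr"
  assumes dsp: "dspace T D"
    and X12: "X1 \<subseteq> topspace T" "X2 \<subseteq> topspace T"
    and cover: "topspace T = T interior_of X1 \<union> T interior_of X2"
    and dipaths_X: "\<forall>p. p \<in> D \<longleftrightarrow> finite_concat_of (dipaths D X1) (dipaths D X2) p"
    and AB0: "A0 \<subseteq> B0" "B0 \<subseteq> X1 \<inter> X2"
    and AB1: "A1 \<subseteq> B1" "B1 \<subseteq> X1"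
    and AB2: "A2 \<subseteq> B2" "B2 \<subseteq> X2"
    and A0_eq: "A0 = A1 \<inter> A2" and B0_eq: "B0 = B1 \<inter> B2"
    and A_cover: "A1 \<union> A2 = (subtopology T (A1 \<union> A2)) interior_of A1
                           \<union> (subtopology T (A1 \<union> A2)) interior_of A2"
    and B_cover: "B1 \<union> B2 = (subtopology T (B1 \<union> B2)) interior_of B1
                           \<union> (subtopology T (B1 \<union> B2)) interior_of B2"
    \<comment> \<open>compatible future retracts Q_k : pi1(X_k) -> pi1(X_k, B_k)\<close>
    and Q0: "future_retract (fcat T D (X1 \<inter> X2) (X1 \<inter> X2)) (fcat T D (X1 \<inter> X2) B0)
               (incl T D (X1 \<inter> X2)) Q0 \<theta>0"
    and Q1: "future_retract (fcat T D X1 X1) (fcat T D X1 B1) (incl T D X1) Q1 \<theta>1"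
    and Q2: "future_retract (fcat T D X2 X2) (fcat T D X2 B2) (incl T D X2) Q2 \<theta>2"
    and Q1_comm: "feq (fcat T D (X1 \<inter> X2) (X1 \<inter> X2))
                    (fcomp Q1 (incl T D X1)) (fcomp (incl T D X1) Q0)"
    and Q2_comm: "feq (fcat T D (X1 \<inter> X2) (X1 \<inter> X2))
                    (fcomp Q2 (incl T D X2)) (fcomp (incl T D X2) Q0)"
    and \<theta>1_comm: "\<forall>x\<in>X1 \<inter> X2. FArr (incl T D X1) (\<theta>0 x) = \<theta>1 x"
    and \<theta>2_comm: "\<forall>x\<in>X1 \<inter> X2. FArr (incl T D X2) (\<theta>0 x) = \<theta>2 x"
    \<comment> \<open>compatible future retracts P_k : pi1(X_k, B_k) -> pi1(X_k, A_k)\<close>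
    and P0: "future_retract (fcat T D (X1 \<inter> X2) B0) (fcat T D (X1 \<inter> X2) A0)
               (incl T D (X1 \<inter> X2)) P0 \<eta>0"
    and P1: "future_retract (fcat T D X1 B1) (fcat T D X1 A1) (incl T D X1) P1 \<eta>1"
    and P2: "future_retract (fcat T D X2 B2) (fcat T D X2 A2) (incl T D X2) P2 \<eta>2"
    and P1_comm: "feq (fcat T D (X1 \<inter> X2) B0)
                    (fcomp P1 (incl T D X1)) (fcomp (incl T D X1) P0)"
    and P2_comm: "feq (fcat T D (X1 \<inter> X2) B0)
                    (fcomp P2 (incl T D X2)) (fcomp (incl T D X2) P0)"
    and \<eta>1_comm: "\<forall>x\<in>B0. FArr (incl T D X1) (\<eta>0 x) = \<eta>1 x"
    and \<eta>2_comm: "\<forall>x\<in>B0. FArr (incl T D X2) (\<eta>0 x) = \<eta>2 x"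
  shows "arrow_cube
           (fcat T D (X1 \<inter> X2) A0) (fcat T D (X1 \<inter> X2) B0) (incl T D (X1 \<inter> X2))
           (fcat T D X1 A1) (fcat T D X1 B1) (incl T D X1)
           (fcat T D X2 A2) (fcat T D X2 B2) (incl T D X2)
           (fcat T D (topspace T) (A1 \<union> A2)) (fcat T D (topspace T) (B1 \<union> B2)) (incl T D (topspace T))
           (incl T D X1) (incl T D X1) (incl T D X2) (incl T D X2)
           (incl T D (topspace T)) (incl T D (topspace T)) (incl T D (topspace T)) (incl T D (topspace T))
       \<and> (\<forall>(C' :: ('o1, 'm1) cat) (D' :: ('o2, 'm2) cat) g.
           is_category C' \<and> is_category D' \<and> is_functor g C' D' \<longrightarrow>
           arrow_po_univ
           (fcat T D (X1 \<inter> X2) A0) (fcat T D (X1 \<inter> X2) B0) (incl T D (X1 \<inter> X2))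
           (fcat T D X1 A1) (fcat T D X1 B1) (incl T D X1)
           (fcat T D X2 A2) (fcat T D X2 B2) (incl T D X2)
           (fcat T D (topspace T) (A1 \<union> A2)) (fcat T D (topspace T) (B1 \<union> B2)) (incl T D (topspace T))
           (incl T D X1) (incl T D X1) (incl T D X2) (incl T D X2)
           (incl T D (topspace T)) (incl T D (topspace T)) (incl T D (topspace T)) (incl T D (topspace T))
           C' D' g)"
proof -
  interpret d_cover T D X1 X2 by unfold_locales (use dsp X12 cover in auto)
  have X0: "X1 \<inter> X2 \<subseteq> X1" "X1 \<inter> X2 \<subseteq> X2" "X1 \<inter> X2 \<subseteq> X" using X12 by auto
  have A: "A0 \<subseteq> X1 \<inter> X2" "A1 \<subseteq> X1" "A2 \<subseteq> X2" "A1 \<union> A2 \<subseteq> B1 \<union> B2" "A1 \<union> A2 \<subseteq> X" "B1 \<union> B2 \<subseteq> X"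
    using AB0 AB1 AB2 X12 by auto
  have A0: "A0 \<subseteq> A1" "A0 \<subseteq> A2" "B0 \<subseteq> B1" "B0 \<subseteq> B2" using A0_eq B0_eq by auto
  note rQ = Q0[THEN unital_retract_future_retract] Q1[THEN unital_retract_future_retract]
    Q2[THEN unital_retract_future_retract]
  interpret B: d_retract T D X1 X2 B1 B2 Q0 Q1 Q2 \<theta>0 \<theta>1 \<theta>2
    by unfold_locales (use AB1 AB2 rQ Q1_comm Q2_comm \<theta>1_comm \<theta>2_comm B0_eq in auto)
  \<comment> \<open>Each unit goes first along \<open>\<theta>\<close> into the points of
    \<open>B\<close> and then along \<open>\<eta>\<close> into those of \<open>A\<close>, as in
    \<open>unital_retract_comp\<close>.\<close>
  interpret A: d_retract T D X1 X2 A1 A2 "fcomp P0 Q0" "fcomp P1 Q1" "fcomp P2 Q2"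
    "\<lambda>x. Comp (fcat T D (X1 \<inter> X2) (X1 \<inter> X2)) (\<eta>0 (FObj Q0 x)) (\<theta>0 x)"
    "\<lambda>x. Comp (fcat T D X1 X1) (\<eta>1 (FObj Q1 x)) (\<theta>1 x)"
    "\<lambda>x. Comp (fcat T D X2 X2) (\<eta>2 (FObj Q2 x)) (\<theta>2 x)"
  proof unfold_locales
    show "A1 \<subseteq> X1" "A2 \<subseteq> X2" by (fact A)+
    show "unital_retract T D (X1 \<inter> X2) (A1 \<inter> A2) (fcomp P0 Q0)
      (\<lambda>x. Comp (fcat T D (X1 \<inter> X2) (X1 \<inter> X2)) (\<eta>0 (FObj Q0 x)) (\<theta>0 x))"
      unfolding A0_eq[symmetric] by (rule unital_retract_comp[OF rQ(1) P0 AB0 X0(3)])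
    show "unital_retract T D X1 A1 (fcomp P1 Q1) (\<lambda>x. Comp (fcat T D X1 X1) (\<eta>1 (FObj Q1 x)) (\<theta>1 x))"
      by (rule unital_retract_comp[OF rQ(2) P1 AB1 X12(1)])
    show "unital_retract T D X2 A2 (fcomp P2 Q2) (\<lambda>x. Comp (fcat T D X2 X2) (\<eta>2 (FObj Q2 x)) (\<theta>2 x))"
      by (rule unital_retract_comp[OF rQ(3) P2 AB2 X12(2)])
  qed (rule compatible_retracts_comp[OF X0(1) AB0(2) rQ(1) P0 Q1_comm \<theta>1_comm P1_comm \<eta>1_comm]
      compatible_retracts_comp[OF X0(2) AB0(2) rQ(1) P0 Q2_comm \<theta>2_comm P2_comm \<eta>2_comm])+
  let ?A = "fcat T D X (A1 \<union> A2)" and ?B = "fcat T D X (B1 \<union> B2)" and ?\<iota> = "incl T D X"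
  have incl_eq: "feq (fcat T D Y S) (fcomp (incl T D W) (incl T D Z)) (fcomp (incl T D W) (incl T D Z'))"
    if "Y \<subseteq> Z" "Z \<subseteq> W" "Y \<subseteq> Z'" "Z' \<subseteq> W" for Y Z Z' W S
    using that by (auto simp: feq_def FArr_incl_incl)
  have cube: "arrow_cube
           (fcat T D (X1 \<inter> X2) A0) (fcat T D (X1 \<inter> X2) B0) (incl T D (X1 \<inter> X2))
           (fcat T D X1 A1) (fcat T D X1 B1) (incl T D X1)
           (fcat T D X2 A2) (fcat T D X2 B2) (incl T D X2)
           ?A ?B ?\<iota> (incl T D X1) (incl T D X1) (incl T D X2) (incl T D X2) ?\<iota> ?\<iota> ?\<iota> ?\<iota>"
    unfolding arrow_cube_def arrmor_def
    by (intro conjI is_category_fcat is_functor_incl incl_eq)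
      (use A A0 AB0 AB1 AB2 X12 X0 in auto)
  have univ: "arrow_po_univ
           (fcat T D (X1 \<inter> X2) A0) (fcat T D (X1 \<inter> X2) B0) (incl T D (X1 \<inter> X2))
           (fcat T D X1 A1) (fcat T D X1 B1) (incl T D X1)
           (fcat T D X2 A2) (fcat T D X2 B2) (incl T D X2)
           ?A ?B ?\<iota> (incl T D X1) (incl T D X1) (incl T D X2) (incl T D X2) ?\<iota> ?\<iota> ?\<iota> ?\<iota> C' D' g"
    if cats: "is_category C'" "is_category D'" and g: "is_functor g C' D'"
    for C' :: "('o1, 'm1) cat" and D' :: "('o2, 'm2) cat" and g
    unfolding arrow_po_univ_def
  proof (intro allI impI, elim conjE)
    fix u1 v1 u2 v2
    assume m1: "arrmor (fcat T D X1 A1) (fcat T D X1 B1) (incl T D X1) C' D' g u1 v1"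
      and m2: "arrmor (fcat T D X2 A2) (fcat T D X2 B2) (incl T D X2) C' D' g u2 v2"
      and u12: "feq (fcat T D (X1 \<inter> X2) A0) (fcomp u1 (incl T D X1)) (fcomp u2 (incl T D X2))"
      and v12: "feq (fcat T D (X1 \<inter> X2) B0) (fcomp v1 (incl T D X1)) (fcomp v2 (incl T D X2))"
    have fu: "is_functor u1 (fcat T D X1 A1) C'" "is_functor u2 (fcat T D X2 A2) C'"
      and fv: "is_functor v1 (fcat T D X1 B1) D'" "is_functor v2 (fcat T D X2 B2) D'"
      using m1 m2 by (simp_all add: arrmor_def)
    obtain u where u: "is_functor u ?A C'" "feq (fcat T D X1 A1) (fcomp u ?\<iota>) u1" "feq (fcat T D X2 A2) (fcomp u ?\<iota>) u2"
      using A.retract_pushout_exists[OF cats(1) fu u12[unfolded A0_eq]] by metis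
    obtain v where v: "is_functor v ?B D'" "feq (fcat T D X1 B1) (fcomp v ?\<iota>) v1" "feq (fcat T D X2 B2) (fcomp v ?\<iota>) v2"
      using B.retract_pushout_exists[OF cats(2) fv v12[unfolded B0_eq]] by metis
    \<comment> \<open>Over one piece both composites reduce to \<open>g\<close> after
      \<open>uk\<close>, which is \<open>vk\<close> on the smaller object set. The two copies of
      \<open>\<iota>\<close> on the right are the passage to \<open>X\<close> and the passage from
      the points of \<open>A\<close> to those of \<open>B\<close>.\<close>
    have side: "feq (fcat T D Y S) (fcomp (fcomp g u) ?\<iota>) (fcomp (fcomp v ?\<iota>) ?\<iota>)"
      if m: "arrmor (fcat T D Y S) (fcat T D Y S') (incl T D Y) C' D' g uk vk"
        and uk: "feq (fcat T D Y S) (fcomp u ?\<iota>) uk" and vk: "feq (fcat T D Y S') (fcomp v ?\<iota>) vk"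
        and S: "S \<subseteq> S'" "Y \<subseteq> X" for Y S S' uk vk
      unfolding feq_def
    proof (intro conjI ballI)
      fix a assume "a \<in> Obj (fcat T D Y S)"
      then show "FObj (fcomp (fcomp g u) ?\<iota>) a = FObj (fcomp (fcomp v ?\<iota>) ?\<iota>) a"
        using m uk vk S by (auto simp: arrmor_def feq_def)
    next
      fix f assume f: "f \<in> Arr (fcat T D Y S)"
      then have f': "f \<in> Arr (fcat T D Y S')" using Arr_fcat_mono[OF S(1)] by blast
      have "FArr g (FArr u (FArr ?\<iota> f)) = FArr g (FArr uk f)" using feqD(2)[OF uk f] by simp
      also have "\<dots> = FArr vk f" using m f FArr_incl_id[OF f] by (simp add: arrmor_def feq_def)
      also have "\<dots> = FArr v (FArr ?\<iota> f)" using feqD(2)[OF vk f'] by simp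
      also have "\<dots> = FArr v (FArr ?\<iota> (FArr ?\<iota> f))" using FArr_incl_incl[OF f S(2)] by simp
      finally show "FArr (fcomp (fcomp g u) ?\<iota>) f = FArr (fcomp (fcomp v ?\<iota>) ?\<iota>) f" by simp
    qed
    \<comment> \<open>Commutativity of the mediating square is uniqueness at the level of
      \<open>A\<close>, applied with target \<open>D'\<close> in place of \<open>C'\<close>.\<close>
    have "feq ?A (fcomp g u) (fcomp v ?\<iota>)"
    proof (rule A.retract_pushout_unique)
      show "is_functor (fcomp g u) ?A D'" by (rule is_functor_fcomp[OF u(1) g])
      show "is_functor (fcomp v ?\<iota>) ?A D'"
        by (rule is_functor_fcomp[OF is_functor_incl[OF A(4) order_refl] v(1)])
    qed (rule side[OF m1 u(2) v(2) AB1(1) X12(1)] side[OF m2 u(3) v(3) AB2(1) X12(2)])+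
    then have uv: "arrmor ?A ?B ?\<iota> C' D' g u v" using u v by (simp add: arrmor_def)
    show "\<exists>u v. arrmor ?A ?B ?\<iota> C' D' g u v \<and>
               feq (fcat T D X1 A1) (fcomp u ?\<iota>) u1 \<and> feq (fcat T D X1 B1) (fcomp v ?\<iota>) v1 \<and>
               feq (fcat T D X2 A2) (fcomp u ?\<iota>) u2 \<and> feq (fcat T D X2 B2) (fcomp v ?\<iota>) v2 \<and>
               (\<forall>u' v'. arrmor ?A ?B ?\<iota> C' D' g u' v' \<and>
                   feq (fcat T D X1 A1) (fcomp u' ?\<iota>) u1 \<and> feq (fcat T D X1 B1) (fcomp v' ?\<iota>) v1 \<and>
                   feq (fcat T D X2 A2) (fcomp u' ?\<iota>) u2 \<and> feq (fcat T D X2 B2) (fcomp v' ?\<iota>) v2 \<longrightarrow>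
                   feq ?A u' u \<and> feq ?B v' v)"
    proof (rule exI[of _ u], rule exI[of _ v], intro conjI allI impI; (elim conjE)?)
      fix u' v'
      assume m': "arrmor ?A ?B ?\<iota> C' D' g u' v'"
        and u': "feq (fcat T D X1 A1) (fcomp u' ?\<iota>) u1" "feq (fcat T D X2 A2) (fcomp u' ?\<iota>) u2"
        and v': "feq (fcat T D X1 B1) (fcomp v' ?\<iota>) v1" "feq (fcat T D X2 B2) (fcomp v' ?\<iota>) v2"
      have "is_functor u' ?A C'" "is_functor v' ?B D'" using m' by (simp_all add: arrmor_def)
      then show "feq ?A u' u" "feq ?B v' v"
        using A.retract_pushout_unique[OF _ u(1) feq_trans_sym[OF u'(1) u(2)] feq_trans_sym[OF u'(2) u(3)]]
          B.retract_pushout_unique[OF _ v(1) feq_trans_sym[OF v'(1) v(2)] feq_trans_sym[OF v'(2) v(3)]] by blast+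
    qed (fact uv u v)+
  qed
  show ?thesis using cube univ by blast
qed

end
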